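(* For any $n \geq 4$, there are $\lfloor \frac{n+1}{2} \rfloor$ completely independent spanning trees in $L(K_n)$ such that, for $n=4$ or any odd $n \geq 5$ and any vertex $v$ of $L(K_n)$ (respectively, for any even $n \geq 6$ and any induced path $P$ of order at most $\frac{n}{2}$ of $L(K_n)$), $\lfloor \frac{n+1}{2} \rfloor$ completely independent spanning trees still exist in $L(K_n)-v$ (respectively, in $L(K_n)-V(P)$).
   Context: $K_n$ is the complete graph on $n$ vertices, and $L(K_n)$ its line graph (vertex set $E(K_n)$, two vertices adjacent iff the corresponding edges share an endpoint). Spanning trees $T_1,\dots,T_k$ of a graph $H$ are completely independent if for any two distinct vertices $u,v$ of $H$, the $u$–$v$ paths in $T_1,\dots,T_k$ are pairwise edge-disjoint and pairwise share no vertex other than $u$ and $v$. An induced path of a graph $H$ is a set of vertices inducing a path in $H$; $H-X$ denotes deletion of the vertex set $X$. *)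

theory Defs
  imports Main
begin

record 'a sgraph =
  vertices :: "'a set"
  edges :: "'a set set"

definition simple_graph :: "'a sgraph \<Rightarrow> bool" where
  "simple_graph G \<longleftrightarrow>
     finite (vertices G) \<and> (\<forall>e\<in>edges G. e \<subseteq> vertices G \<and> card e = 2)"

definition complete_graph :: "nat \<Rightarrow> nat sgraph" where
  "complete_graph n =
     \<lparr>vertices = {..<n}, edges = {e. e \<subseteq> {..<n} \<and> card e = 2}\<rparr>"

definition line_graph :: "'a sgraph \<Rightarrow> 'a set sgraph" where
  "line_graph G =
     \<lparr>vertices = edges G,
      edges = {{e, f} |e f. e \<in> edges G \<and> f \<in> edges G \<and> e \<noteq> f \<and> e \<inter> f \<noteq> {}}\<rparr>"

definition induced_sgraph :: "'a sgraph \<Rightarrow> 'a set \<Rightarrow> 'a sgraph" where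
  "induced_sgraph G X =
     \<lparr>vertices = vertices G \<inter> X, edges = {e \<in> edges G. e \<subseteq> X}\<rparr>"

definition delete_vertices :: "'a sgraph \<Rightarrow> 'a set \<Rightarrow> 'a sgraph" where
  "delete_vertices G X = induced_sgraph G (vertices G - X)"

text \<open>Walks and paths are given by their nonempty list of successive vertices.\<close>

definition walk_edges :: "'a list \<Rightarrow> 'a set set" where
  "walk_edges p = {{p ! i, p ! Suc i} |i. Suc i < length p}"

definition walk_betw :: "'a sgraph \<Rightarrow> 'a \<Rightarrow> 'a list \<Rightarrow> 'a \<Rightarrow> bool" where
  "walk_betw G u p v \<longleftrightarrow>
     p \<noteq> [] \<and> hd p = u \<and> last p = v \<and> set p \<subseteq> vertices G \<and> walk_edges p \<subseteq> edges G"

definition path_betw :: "'a sgraph \<Rightarrow> 'a \<Rightarrow> 'a list \<Rightarrow> 'a \<Rightarrow> bool" where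
  "path_betw G u p v \<longleftrightarrow> walk_betw G u p v \<and> distinct p"

definition connected_sgraph :: "'a sgraph \<Rightarrow> bool" where
  "connected_sgraph G \<longleftrightarrow>
     vertices G \<noteq> {} \<and> (\<forall>u\<in>vertices G. \<forall>v\<in>vertices G. \<exists>p. walk_betw G u p v)"

text \<open>A cycle is listed without repeating its first vertex at the end.\<close>

definition is_cycle :: "'a sgraph \<Rightarrow> 'a list \<Rightarrow> bool" where
  "is_cycle G c \<longleftrightarrow>
     3 \<le> length c \<and> path_betw G (hd c) c (last c) \<and> {last c, hd c} \<in> edges G"

definition is_tree :: "'a sgraph \<Rightarrow> bool" where
  "is_tree T \<longleftrightarrow> simple_graph T \<and> connected_sgraph T \<and> (\<nexists>c. is_cycle T c)"

definition is_spanning_tree :: "'a sgraph \<Rightarrow> 'a sgraph \<Rightarrow> bool" where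
  "is_spanning_tree T H \<longleftrightarrow>
     is_tree T \<and> vertices T = vertices H \<and> edges T \<subseteq> edges H"

definition completely_independent_spanning_trees :: "'a sgraph \<Rightarrow> 'a sgraph list \<Rightarrow> bool" where
  "completely_independent_spanning_trees H Ts \<longleftrightarrow>
     (\<forall>T\<in>set Ts. is_spanning_tree T H) \<and>
     (\<forall>u\<in>vertices H. \<forall>v\<in>vertices H. u \<noteq> v \<longrightarrow>
        (\<forall>i<length Ts. \<forall>j<length Ts. i \<noteq> j \<longrightarrow>
           (\<forall>p q. path_betw (Ts ! i) u p v \<longrightarrow> path_betw (Ts ! j) u q v \<longrightarrow>
              walk_edges p \<inter> walk_edges q = {} \<and> set p \<inter> set q \<subseteq> {u, v})))"

definition has_cists :: "'a sgraph \<Rightarrow> nat \<Rightarrow> bool" where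
  "has_cists H k \<longleftrightarrow>
     (\<exists>Ts. length Ts = k \<and> completely_independent_spanning_trees H Ts)"

definition is_path_graph :: "'a sgraph \<Rightarrow> bool" where
  "is_path_graph G \<longleftrightarrow>
     (\<exists>p. p \<noteq> [] \<and> distinct p \<and> vertices G = set p \<and> edges G = walk_edges p)"

definition induced_path :: "'a sgraph \<Rightarrow> 'a set \<Rightarrow> bool" where
  "induced_path H P \<longleftrightarrow> P \<subseteq> vertices H \<and> is_path_graph (induced_sgraph H P)"

end

theory Submission
  imports Defs
begin

text \<open>
  Suppose the vertices of a graph are partitioned into classes such that every class is connected
  and, for any two classes \<open>A\<close> and \<open>B\<close>, every vertex of \<open>A \<union> B\<close> can be assigned a neighbour in the
  other class so that no two vertices are assigned to each other. A spanning tree of each class, with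
  all other vertices hung below it as leaves along these assignments, yields completely independent
  spanning trees: an inner vertex of a tree lies in the class of that tree.

  For \<open>L(K\<^sub>n)\<close> the classes are edge-disjoint paths of \<open>K\<^sub>n\<close> with \<open>n - 2\<close> edges, missing pairwise
  distinct vertices. For \<open>n = 2k\<close> they are the zigzag Hamiltonian paths of \<open>\<int>/2k\<close> without one end edge;
  the removed end edges form a path with \<open>k\<close> edges. For \<open>n = 2m + 1\<close> they are the Hamiltonian cycles
  of Walecki without the vertex opposite to \<open>\<infinity>\<close>; the removed edges, except one, form the last path. To
  link two paths, each is rooted at the vertex missed by the other, and every edge is assigned to an
  edge of the other path at its end away from the root.

  Further edges of \<open>K\<^sub>n\<close> can always be added to a class, and \<open>K\<^sub>n\<close> has all permutations as automorphisms,
  so one deleted set of maximal size is enough.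
\<close>

section \<open>Partitions yielding completely independent spanning trees\<close>

text \<open>Connectedness by a witness: parent pointers towards \<open>r\<close> along which the
  rank drops. The witness is a spanning tree already, so it can be extended by leaves and
  transported along maps.\<close>

definition rooted :: "'a sgraph \<Rightarrow> 'a set \<Rightarrow> bool" where
  "rooted G A \<longleftrightarrow> (\<exists>r par (rank :: 'a \<Rightarrow> nat). r \<in> A \<and>
     (\<forall>x\<in>A - {r}. par x \<in> A \<and> {x, par x} \<in> edges G \<and> rank (par x) < rank x))"

text \<open>Every vertex owns an edge to the other class, and the last condition keeps an edge from
  being owned by both of its ends. Since the classes are meant to be disjoint, one function serves
  both directions.\<close>

definition linked :: "'a sgraph \<Rightarrow> 'a set \<Rightarrow> 'a set \<Rightarrow> bool" where
  "linked G A B \<longleftrightarrow> (\<exists>h. \<forall>x\<in>A \<union> B. {x, h x} \<in> edges G \<and>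
     (x \<in> A \<longrightarrow> h x \<in> B) \<and> (x \<in> B \<longrightarrow> h x \<in> A) \<and> h (h x) \<noteq> x)"

definition dominating :: "'a sgraph \<Rightarrow> 'a set \<Rightarrow> bool" where
  "dominating G A \<longleftrightarrow> (\<forall>x\<in>vertices G - A. \<exists>y\<in>A. {x, y} \<in> edges G)"

text \<open>Vertices outside all classes are allowed, so that the same classes serve for several
  deleted sets. Covering is demanded separately where the trees are built.\<close>

definition cist_partition :: "'a sgraph \<Rightarrow> nat \<Rightarrow> (nat \<Rightarrow> 'a set) \<Rightarrow> bool" where
  "cist_partition G k V \<longleftrightarrow>
     (\<forall>i<k. V i \<subseteq> vertices G \<and> rooted G (V i)) \<and>
     (\<forall>i<k. \<forall>j<k. i \<noteq> j \<longrightarrow> V i \<inter> V j = {} \<and> linked G (V i) (V j))"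

lemma linked_sym:
  assumes "linked G A B" shows "linked G B A"
proof -
  obtain h where "\<forall>x\<in>A \<union> B. {x, h x} \<in> edges G \<and>
      (x \<in> A \<longrightarrow> h x \<in> B) \<and> (x \<in> B \<longrightarrow> h x \<in> A) \<and> h (h x) \<noteq> x"
    using assms unfolding linked_def by blast
  then show ?thesis unfolding linked_def by (intro exI[of _ h]) auto
qed

section \<open>Walks, and trees given by parent functions\<close>

lemma walk_edges_Cons:
  assumes "p \<noteq> []" shows "walk_edges (x # p) = insert {x, hd p} (walk_edges p)"
proof
  show "walk_edges (x # p) \<subseteq> insert {x, hd p} (walk_edges p)"
  proof
    fix e assume "e \<in> walk_edges (x # p)"
    then obtain i where i: "i < length p" "e = {(x # p) ! i, p ! i}"
      unfolding walk_edges_def by auto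
    show "e \<in> insert {x, hd p} (walk_edges p)"
      using i assms by (cases i) (auto simp: hd_conv_nth walk_edges_def)
  qed
  show "insert {x, hd p} (walk_edges p) \<subseteq> walk_edges (x # p)"
  proof
    fix e assume "e \<in> insert {x, hd p} (walk_edges p)"
    then consider "e = {x, hd p}" | i where "Suc i < length p" "e = {p ! i, p ! Suc i}"
      unfolding walk_edges_def by blast
    then show "e \<in> walk_edges (x # p)"
    proof cases
      case 1
      then show ?thesis
        unfolding walk_edges_def using assms by (intro CollectI exI[of _ 0]) (auto simp: hd_conv_nth)
    next
      case (2 i)
      then show ?thesis unfolding walk_edges_def by (intro CollectI exI[of _ "Suc i"]) auto
    qed
  qed
qed

lemma walk_edges_snoc: "p \<noteq> [] \<Longrightarrow> walk_edges (p @ [x]) = insert {last p, x} (walk_edges p)"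
proof (induction p)
  case (Cons a p)
  then show ?case
    by (cases "p = []") (auto simp: walk_edges_Cons, auto simp: walk_edges_def)
qed simp

lemma walk_betw_Cons:
  "walk_betw G u p v \<Longrightarrow> {w, u} \<in> edges G \<Longrightarrow> w \<in> vertices G \<Longrightarrow> walk_betw G w (w # p) v"
  unfolding walk_betw_def by (auto simp: walk_edges_Cons)

lemma walk_betw_snoc:
  "walk_betw G u p v \<Longrightarrow> {v, w} \<in> edges G \<Longrightarrow> w \<in> vertices G \<Longrightarrow> walk_betw G u (p @ [w]) w"
  unfolding walk_betw_def by (auto simp: walk_edges_snoc)

lemma walk_betw_self: "u \<in> vertices G \<Longrightarrow> walk_betw G u [u] u"
  unfolding walk_betw_def walk_edges_def by auto

lemma cycle_edges:
  assumes "is_cycle G c" "i < length c"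
  shows "{c ! i, c ! (Suc i mod length c)} \<in> edges G"
proof (cases "Suc i < length c")
  case True
  then show ?thesis
    using assms unfolding is_cycle_def path_betw_def walk_betw_def walk_edges_def by auto
next
  case False
  then have "Suc i = length c" using assms by simp
  then show ?thesis
    using assms unfolding is_cycle_def path_betw_def walk_betw_def
    by (metis diff_Suc_1 hd_conv_nth last_conv_nth mod_self)
qed

text \<open>Following parents joins every vertex to \<open>r\<close>. On a cycle, a vertex of
  maximal rank could have only its parent as a neighbour, but its two neighbours there are
  distinct.\<close>

lemma is_tree_parent_function:
  fixes rank :: "'a \<Rightarrow> nat"
  assumes "finite V" "r \<in> V"
    and par: "\<And>x. x \<in> V - {r} \<Longrightarrow> par x \<in> V \<and> rank (par x) < rank x"
  shows "is_tree \<lparr>vertices = V, edges = {{x, par x} |x. x \<in> V - {r}}\<rparr>" (is "is_tree ?T")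
proof -
  have "simple_graph ?T"
    unfolding simple_graph_def using assms by (fastforce simp: card_insert_if)
  moreover have "connected_sgraph ?T"
  proof -
    have from_root: "\<exists>p. walk_betw ?T r p v" if "v \<in> V" for v
      using that
    proof (induction "rank v" arbitrary: v rule: less_induct)
      case less
      show ?case
      proof (cases "v = r")
        case True
        then show ?thesis using walk_betw_self[of r ?T] assms by auto
      next
        case False
        with less par obtain p where "walk_betw ?T r p (par v)" by blast
        moreover have "{par v, v} \<in> edges ?T" using False less by auto
        ultimately have "walk_betw ?T r (p @ [v]) v" by (rule walk_betw_snoc) (simp add: less.prems)
        then show ?thesis by blast
      qed
    qed
    have "\<exists>p. walk_betw ?T u p v" if "u \<in> V" "v \<in> V" for u v
      using that(1)
    proof (induction "rank u" arbitrary: u rule: less_induct)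
      case less
      show ?case
      proof (cases "u = r")
        case True
        then show ?thesis using from_root that by auto
      next
        case False
        with less par obtain p where "walk_betw ?T (par u) p v" by blast
        moreover have "{u, par u} \<in> edges ?T" using False less by auto
        ultimately have "walk_betw ?T u (u # p) v" by (rule walk_betw_Cons) (simp add: less.prems)
        then show ?thesis by blast
      qed
    qed
    then show ?thesis unfolding connected_sgraph_def using assms by auto
  qed
  moreover have "\<not> is_cycle ?T c" for c
  proof
    assume c: "is_cycle ?T c"
    let ?l = "length c"
    have l: "3 \<le> ?l" and d: "distinct c"
      using c unfolding is_cycle_def path_betw_def by auto
    have "finite (rank ` set c)" "rank ` set c \<noteq> {}" using l by auto
    then obtain i where i: "i < ?l" "rank (c ! i) = Max (rank ` set c)"
      by (metis (mono_tags, lifting) Max_in imageE in_set_conv_nth)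
    have max: "rank (c ! j) \<le> rank (c ! i)" if "j < ?l" for j
      using that i by auto
    have nb: "c ! j = par (c ! i)" if "j < ?l" "{c ! i, c ! j} \<in> edges ?T" for j
    proof -
      from that obtain x where x: "x \<in> V - {r}" "{c ! i, c ! j} = {x, par x}" by auto
      with par[of x] max[OF that(1)] show ?thesis by (auto simp: doubleton_eq_iff)
    qed
    \<comment> \<open>The positions after and before \<open>i\<close> on the cycle. Adding
      \<open>?l\<close> first prevents truncated subtraction at \<open>i = 0\<close>;
      \<open>3 \<le> ?l\<close> makes them distinct.\<close>
    define a where "a = Suc i mod ?l"
    define b where "b = (i + ?l - 1) mod ?l"
    have "a < ?l" "b < ?l" using i(1) unfolding a_def b_def by (auto intro: mod_less_divisor)
    have "Suc b mod ?l = i"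
    proof (cases i)
      case 0
      then show ?thesis using l i(1) by (simp add: b_def)
    next
      case (Suc j)
      then show ?thesis using l i by (simp add: b_def)
    qed
    then have "{c ! b, c ! i} \<in> edges ?T" using cycle_edges[OF c \<open>b < ?l\<close>] by simp
    then have "c ! b = par (c ! i)" using nb \<open>b < ?l\<close> by (simp add: insert_commute)
    moreover have "c ! a = par (c ! i)"
      using nb[OF \<open>a < ?l\<close>] cycle_edges[OF c i(1)] by (simp add: a_def)
    ultimately have "a = b" using d \<open>a < ?l\<close> \<open>b < ?l\<close> by (metis nth_eq_iff_index_eq)
    moreover have "a \<noteq> b"
    proof (cases i)
      case 0
      then show ?thesis using l by (simp add: a_def b_def)
    next
      case (Suc j)
      then have "b = j" using l i by (simp add: b_def)
      then show ?thesis using Suc l i by (cases "Suc i = ?l") (auto simp: a_def)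
    qed
    ultimately show False by simp
  qed
  ultimately show ?thesis unfolding is_tree_def by blast
qed

text \<open>Serves to exclude leaves of a tree from the interior of its paths.\<close>

lemma path_interior_two_neighbours:
  assumes "path_betw G u p v" "w \<in> set p" "w \<noteq> u" "w \<noteq> v"
  obtains a b where "a \<noteq> b" "{w, a} \<in> edges G" "{w, b} \<in> edges G"
proof -
  from assms obtain i where i: "i < length p" "w = p ! i" by (metis in_set_conv_nth)
  have p: "p \<noteq> []" "distinct p" "hd p = u" "last p = v" "walk_edges p \<subseteq> edges G"
    using assms unfolding path_betw_def walk_betw_def by auto
  have "i \<noteq> 0" using i p assms(3) by (metis hd_conv_nth)
  then obtain j where j: "i = Suc j" by (cases i) auto
  have "Suc i < length p"
    using i p assms(4) by (metis Suc_lessI diff_Suc_1 last_conv_nth)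
  then have "{p ! i, p ! Suc i} \<in> edges G" "{p ! j, p ! Suc j} \<in> edges G"
    using p(5) i j unfolding walk_edges_def by blast+
  moreover have "p ! Suc i \<noteq> p ! j"
    using p \<open>Suc i < length p\<close> j by (simp add: nth_eq_iff_index_eq)
  ultimately show thesis using that i j by (metis insert_commute)
qed

section \<open>Completely independent spanning trees from a partition\<close>

lemma has_cists_if_cist_partition:
  assumes fin: "finite (vertices G)"
    and part: "cist_partition G k V" and cover: "vertices G = (\<Union>i<k. V i)"
  shows "has_cists G k"
proof -
  have V: "V i \<subseteq> vertices G" if "i < k" for i
    using part that unfolding cist_partition_def by blast
  have "\<exists>r par (rank :: 'a \<Rightarrow> nat). r \<in> V i \<and>
      (\<forall>x\<in>V i - {r}. par x \<in> V i \<and> {x, par x} \<in> edges G \<and> rank (par x) < rank x)"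
    if "i < k" for i
    using part that unfolding cist_partition_def rooted_def by blast
  then obtain r par and rank :: "nat \<Rightarrow> 'a \<Rightarrow> nat" where root: "\<And>i. i < k \<Longrightarrow> r i \<in> V i"
    and par: "\<And>i x. i < k \<Longrightarrow> x \<in> V i - {r i} \<Longrightarrow>
       par i x \<in> V i \<and> {x, par i x} \<in> edges G \<and> rank i (par i x) < rank i x"
    by metis
  have "\<exists>h. \<forall>x\<in>V i \<union> V j. {x, h x} \<in> edges G \<and>
     (x \<in> V i \<longrightarrow> h x \<in> V j) \<and> (x \<in> V j \<longrightarrow> h x \<in> V i) \<and> h (h x) \<noteq> x"
    if "i < k" "j < k" "i \<noteq> j" for i j
    using part that unfolding cist_partition_def linked_def by blast
  then obtain h' where h': "\<And>i j. i < k \<Longrightarrow> j < k \<Longrightarrow> i \<noteq> j \<Longrightarrow>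
     \<forall>x\<in>V i \<union> V j. {x, h' i j x} \<in> edges G \<and>
     (x \<in> V i \<longrightarrow> h' i j x \<in> V j) \<and> (x \<in> V j \<longrightarrow> h' i j x \<in> V i) \<and> h' i j (h' i j x) \<noteq> x"
    by metis
  \<comment> \<open>The functions chosen for \<open>(i, j)\<close> and \<open>(j, i)\<close> may
    differ. Trees \<open>i\<close> and \<open>j\<close> must use the same one, since only then does
    the condition against swaps separate their edges.\<close>
  define h where "h i j = h' (min i j) (max i j)" for i j
  have h_comm: "h i j = h j i" for i j
    unfolding h_def by (simp add: min.commute max.commute)
  have h: "{x, h i j x} \<in> edges G \<and> h i j x \<in> V j \<and> h i j (h i j x) \<noteq> x"
    if "i < k" "j < k" "i \<noteq> j" "x \<in> V i" for i j x
  proof (cases "i < j")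
    case True
    then show ?thesis using h'[of i j] that unfolding h_def by (simp add: min_def max_def)
  next
    case False
    then show ?thesis using h'[of j i] that unfolding h_def by (simp add: min_def max_def)
  qed
  have disj: "V i \<inter> V j = {}" if "i < k" "j < k" "i \<noteq> j" for i j
    using part that unfolding cist_partition_def by blast
  have "\<exists>i<k. x \<in> V i" if "x \<in> vertices G" for x
    using cover that by blast
  then obtain c where c: "\<And>x. x \<in> vertices G \<Longrightarrow> c x < k \<and> x \<in> V (c x)"
    by metis
  have c_unique: "c x = i" if "x \<in> V i" "i < k" for x i
    using disj c V that by (metis disjoint_iff subsetD)
  \<comment> \<open>The parent function of tree \<open>i\<close>: inside its class the given tree,
    outside a leaf edge into \<open>V i\<close>, where \<open>c x\<close> is the class of
    \<open>x\<close>.\<close>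
  define q where "q i x = (if x \<in> V i then par i x else h (c x) i x)" for i x
  define T where "T i = \<lparr>vertices = vertices G,
     edges = {{x, q i x} |x. x \<in> vertices G - {r i}}\<rparr>" for i
  have q: "q i x \<in> V i \<and> {x, q i x} \<in> edges G" if "i < k" "x \<in> vertices G - {r i}" for i x
    using par[of i x] h[of "c x" i x] c[of x] c_unique[of x i] that unfolding q_def by auto
  have tree: "is_tree (T i)" if i: "i < k" for i
    unfolding T_def
  proof (rule is_tree_parent_function[OF fin])
    show "r i \<in> vertices G" using root V i by blast
    \<comment> \<open>A common rank for all leaves outside \<open>V i\<close>, above every rank
      inside.\<close>
    define R where "R = Suc (Max (rank i ` V i))"
    have fV: "finite (V i)" using V[OF i] fin finite_subset by blast
    have R: "rank i x < R" if "x \<in> V i" for x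
      using that fV unfolding R_def by (simp add: le_imp_less_Suc)
    fix x assume x: "x \<in> vertices G - {r i}"
    show "q i x \<in> vertices G \<and>
        (if q i x \<in> V i then rank i (q i x) else R) < (if x \<in> V i then rank i x else R)"
      using q[OF i x] V[OF i] par[OF i] R x unfolding q_def by auto
  qed
  have span: "is_spanning_tree (T i) G" if "i < k" for i
    unfolding is_spanning_tree_def using tree[OF that] q[OF that] by (auto simp: T_def)
  \<comment> \<open>All parents in tree \<open>i\<close> lie in \<open>V i\<close>, so a vertex
    outside \<open>V i\<close> has at most one neighbour, its own parent.\<close>
  have inner: "w \<in> V i" if "i < k" "path_betw (T i) u p v" "w \<in> set p" "w \<noteq> u" "w \<noteq> v" for i u p v w
  proof (rule ccontr)
    assume w: "w \<notin> V i"
    have "a = q i w" if "{w, a} \<in> edges (T i)" for a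
      using that q[OF \<open>i < k\<close>] w unfolding T_def by (auto simp: doubleton_eq_iff)
    then show False using path_interior_two_neighbours[OF that(2-5)] by metis
  qed
  \<comment> \<open>The parent ends of a shared edge lie in different classes, so they are its two
    different ends. Then each end is assigned to the other by \<open>h i j\<close>, a forbidden
    swap.\<close>
  have edge_disj: "edges (T i) \<inter> edges (T j) = {}" if ij: "i < k" "j < k" "i \<noteq> j" for i j
  proof (rule ccontr)
    assume "edges (T i) \<inter> edges (T j) \<noteq> {}"
    then obtain x y where x: "x \<in> vertices G - {r i}" and y: "y \<in> vertices G - {r j}"
      and eq: "{x, q i x} = {y, q j y}" by (auto simp: T_def)
    have qx: "q i x \<in> V i" and qy: "q j y \<in> V j" using q ij x y by auto
    have "q i x \<noteq> q j y" using qx qy disj[OF ij] by auto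
    then have xy: "x = q j y" "y = q i x" using eq by (auto simp: doubleton_eq_iff)
    then have "x \<in> V j" "y \<in> V i" using qx qy by auto
    then have "x \<notin> V i" "y \<notin> V j" using disj[OF ij] by auto
    have "q i x = h j i x" "q j y = h i j y"
      using \<open>x \<notin> V i\<close> \<open>y \<notin> V j\<close> c_unique[OF \<open>x \<in> V j\<close> ij(2)] c_unique[OF \<open>y \<in> V i\<close> ij(1)]
      by (simp_all add: q_def)
    then have "y = h j i x" "x = h i j y" using trans[OF xy(2)] trans[OF xy(1)] by blast+
    then show False using h[OF ij \<open>y \<in> V i\<close>] h_comm by metis
  qed
  have "completely_independent_spanning_trees G (map T [0..<k])"
    unfolding completely_independent_spanning_trees_def
  proof (intro conjI ballI allI impI)
    fix t assume "t \<in> set (map T [0..<k])"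
    then show "is_spanning_tree t G" using span by auto
  next
    fix u v i j p p'
    assume "i < length (map T [0..<k])" "j < length (map T [0..<k])" "i \<noteq> j"
      and p: "path_betw (map T [0..<k] ! i) u p v" "path_betw (map T [0..<k] ! j) u p' v"
    then have ij: "i < k" "j < k" "i \<noteq> j" by auto
    with p have p: "path_betw (T i) u p v" "path_betw (T j) u p' v" by auto
    show "walk_edges p \<inter> walk_edges p' = {}"
      using p edge_disj[OF ij] unfolding path_betw_def walk_betw_def by blast
    show "set p \<inter> set p' \<subseteq> {u, v}"
      using inner[OF ij(1) p(1)] inner[OF ij(2) p(2)] disj[OF ij] by blast
  qed
  then show ?thesis unfolding has_cists_def by (intro exI[of _ "map T [0..<k]"]) simp
qed

section \<open>Induced subgraphs and automorphisms\<close>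

lemma cist_partition_induced:
  assumes "cist_partition G k V" "\<And>i. i < k \<Longrightarrow> V i \<subseteq> F"
  shows "cist_partition (induced_sgraph G F) k V"
proof -
  have "rooted (induced_sgraph G F) A" if A: "rooted G A" "A \<subseteq> F" for A
  proof -
    obtain r par and rank :: "'a \<Rightarrow> nat" where "r \<in> A"
      "\<forall>x\<in>A - {r}. par x \<in> A \<and> {x, par x} \<in> edges G \<and> rank (par x) < rank x"
      using A(1) unfolding rooted_def by blast
    with that(2) show ?thesis unfolding rooted_def induced_sgraph_def
      by (intro exI[of _ r] exI[of _ par] exI[of _ rank]) auto
  qed
  moreover have "linked (induced_sgraph G F) A B" if "linked G A B" "A \<subseteq> F" "B \<subseteq> F" for A B
  proof -
    from that(1) obtain h where h: "\<forall>x\<in>A \<union> B. {x, h x} \<in> edges G \<and>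
     (x \<in> A \<longrightarrow> h x \<in> B) \<and> (x \<in> B \<longrightarrow> h x \<in> A) \<and> h (h x) \<noteq> x" unfolding linked_def by blast
    with that(2,3) show ?thesis unfolding linked_def induced_sgraph_def
      by (intro exI[of _ h]) auto
  qed
  ultimately show ?thesis
    using assms unfolding cist_partition_def by (auto simp: induced_sgraph_def)
qed

text \<open>Surplus vertices are hung as leaves below the first class.\<close>

lemma has_cists_induced:
  assumes fin: "finite (vertices G)" and "0 < k"
    and part: "cist_partition G k V" and dom: "\<And>i. i < k \<Longrightarrow> dominating G (V i)"
    and F: "\<And>i. i < k \<Longrightarrow> V i \<subseteq> F" "F \<subseteq> vertices G"
  shows "has_cists (induced_sgraph G F) k"
proof -
  define R where "R = F - (\<Union>i<k. V i)"
  define W where "W = V(0 := V 0 \<union> R)"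
  have nb: "\<exists>y. \<forall>x\<in>R. y x \<in> V i \<and> {x, y x} \<in> edges G" if "i < k" for i
  proof (rule bchoice, rule ballI)
    fix x assume "x \<in> R"
    then have "x \<in> vertices G - V i" using F(2) that unfolding R_def by auto
    then show "\<exists>y. y \<in> V i \<and> {x, y} \<in> edges G" using dom[OF that] unfolding dominating_def by blast
  qed
  have RV: "R \<inter> V i = {}" if "i < k" for i using that unfolding R_def by auto
  have disj: "V i \<inter> V j = {}" if "i < k" "j < k" "i \<noteq> j" for i j
    using part that unfolding cist_partition_def by blast
  have rooted_R: "rooted G (V 0 \<union> R)"
  proof -
    obtain r par and rank :: "'a \<Rightarrow> nat" where r: "r \<in> V 0"
      and par: "\<forall>x\<in>V 0 - {r}. par x \<in> V 0 \<and> {x, par x} \<in> edges G \<and> rank (par x) < rank x"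
      using part \<open>0 < k\<close> unfolding cist_partition_def rooted_def by blast
    obtain y where y: "\<forall>x\<in>R. y x \<in> V 0 \<and> {x, y x} \<in> edges G" using nb[OF \<open>0 < k\<close>] by blast
    show ?thesis
      unfolding rooted_def
      using r par y RV[OF \<open>0 < k\<close>]
      by (intro exI[of _ r] exI[of _ "\<lambda>x. if x \<in> R then y x else par x"]
          exI[of _ "\<lambda>x. if x \<in> R then Suc (rank (y x)) else rank x"]) (auto simp: disjoint_iff)
  qed
  have linked_R: "linked G (V 0 \<union> R) (V j)" if j: "j < k" "j \<noteq> 0" for j
  proof -
    obtain h where h: "\<forall>x\<in>V 0 \<union> V j. {x, h x} \<in> edges G \<and>
     (x \<in> V 0 \<longrightarrow> h x \<in> V j) \<and> (x \<in> V j \<longrightarrow> h x \<in> V 0) \<and> h (h x) \<noteq> x"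
      using part \<open>0 < k\<close> j unfolding cist_partition_def linked_def by metis
    obtain y where y: "\<forall>x\<in>R. y x \<in> V j \<and> {x, y x} \<in> edges G" using nb[OF j(1)] by blast
    \<comment> \<open>No vertex is assigned to a member of \<open>R\<close>, so the new assignments
      create no swap.\<close>
    show ?thesis
      unfolding linked_def
      using h y RV[OF \<open>0 < k\<close>] RV[OF j(1)] disj[OF \<open>0 < k\<close> j(1)] j
      by (intro exI[of _ "\<lambda>x. if x \<in> R then y x else h x"]) (auto simp: disjoint_iff)
  qed
  have "R \<subseteq> vertices G" using F(2) unfolding R_def by blast
  then have "W i \<subseteq> vertices G \<and> rooted G (W i)" if "i < k" for i
    using part rooted_R that unfolding cist_partition_def W_def by auto
  moreover have "W i \<inter> W j = {} \<and> linked G (W i) (W j)" if ij: "i < k" "j < k" "i \<noteq> j" for i j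
  proof -
    consider "i = 0" | "j = 0" | "i \<noteq> 0" "j \<noteq> 0" by auto
    then show ?thesis
    proof cases
      case 1
      then show ?thesis using ij disj[OF ij] RV[of j] linked_R[of j] unfolding W_def by auto
    next
      case 2
      then show ?thesis
        using ij disj[OF ij] RV[of i] linked_sym[OF linked_R[of i]] unfolding W_def by auto
    next
      case 3
      then show ?thesis using part ij unfolding cist_partition_def W_def by simp
    qed
  qed
  ultimately have "cist_partition G k W" unfolding cist_partition_def by blast
  moreover have W: "(\<Union>i<k. W i) = F"
  proof
    show "(\<Union>i<k. W i) \<subseteq> F" using F(1) \<open>0 < k\<close> unfolding W_def R_def by auto
    show "F \<subseteq> (\<Union>i<k. W i)"
    proof
      fix x assume "x \<in> F"
      then have "x \<in> R \<or> (\<exists>i<k. x \<in> V i)" unfolding R_def by auto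
      then have "\<exists>i<k. x \<in> W i"
      proof
        assume "x \<in> R"
        then show ?thesis using \<open>0 < k\<close> unfolding W_def by auto
      next
        assume "\<exists>i<k. x \<in> V i"
        then obtain i where "i < k" "x \<in> V i" by blast
        moreover from this have "x \<in> W i" unfolding W_def by auto
        ultimately show ?thesis by blast
      qed
      then show "x \<in> (\<Union>i<k. W i)" by blast
    qed
  qed
  ultimately have "cist_partition (induced_sgraph G F) k W"
    by (intro cist_partition_induced) auto
  then show ?thesis
    using fin F(2) W by (intro has_cists_if_cist_partition) (auto simp: induced_sgraph_def)
qed

lemma cist_partition_automorphism:
  assumes part: "cist_partition G k V" and bij: "bij_betw f (vertices G) (vertices G)"
    and hom: "\<And>x y. x \<in> vertices G \<Longrightarrow> y \<in> vertices G \<Longrightarrow> {x, y} \<in> edges G \<Longrightarrow> {f x, f y} \<in> edges G"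
  shows "cist_partition G k (\<lambda>i. f ` V i)"
proof -
  define g where "g = inv_into (vertices G) f"
  have gf: "g (f x) = x" if "x \<in> vertices G" for x
    unfolding g_def using bij that by (simp add: bij_betw_inv_into_left)
  have "rooted G (f ` A)" if A: "rooted G A" "A \<subseteq> vertices G" for A
  proof -
    obtain r par and rank :: "'a \<Rightarrow> nat" where r: "r \<in> A"
      and par: "\<forall>x\<in>A - {r}. par x \<in> A \<and> {x, par x} \<in> edges G \<and> rank (par x) < rank x"
      using A(1) unfolding rooted_def by blast
    show ?thesis
      unfolding rooted_def
    proof (intro exI[of _ "f r"] exI[of _ "\<lambda>x. f (par (g x))"] exI[of _ "\<lambda>x. rank (g x)"] conjI ballI)
      show "f r \<in> f ` A" using r by blast
      fix x assume "x \<in> f ` A - {f r}"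
      then obtain y where y: "y \<in> A - {r}" "x = f y" by blast
      then have "par y \<in> A" "{y, par y} \<in> edges G" "rank (par y) < rank y" using par by auto
      moreover have "g x = y" "y \<in> vertices G" using y gf that(2) by auto
      ultimately show "f (par (g x)) \<in> f ` A" "{x, f (par (g x))} \<in> edges G"
        "rank (g (f (par (g x)))) < rank (g x)"
        using hom gf that(2) y by auto
    qed
  qed
  moreover have "linked G (f ` A) (f ` B)" if AB: "linked G A B" "A \<subseteq> vertices G" "B \<subseteq> vertices G" for A B
  proof -
    obtain h where h: "\<forall>x\<in>A \<union> B. {x, h x} \<in> edges G \<and>
     (x \<in> A \<longrightarrow> h x \<in> B) \<and> (x \<in> B \<longrightarrow> h x \<in> A) \<and> h (h x) \<noteq> x"
      using AB(1) unfolding linked_def by metis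
    have inj: "x = y" if "f x = f y" "x \<in> vertices G" "y \<in> vertices G" for x y
      using that gf by metis
    show ?thesis
      unfolding linked_def
    proof (intro exI[of _ "\<lambda>x. f (h (g x))"] ballI)
      fix x assume "x \<in> f ` A \<union> f ` B"
      then obtain y where y: "y \<in> A \<union> B" "x = f y" by blast
      then have hy: "{y, h y} \<in> edges G" "y \<in> A \<longrightarrow> h y \<in> B" "y \<in> B \<longrightarrow> h y \<in> A" "h (h y) \<noteq> y"
        using h by auto
      have "y \<in> vertices G" "h y \<in> vertices G" using y hy that by auto
      moreover have "h (h y) \<in> vertices G" using y h that by blast
      moreover have "x \<in> f ` A \<Longrightarrow> y \<in> A" "x \<in> f ` B \<Longrightarrow> y \<in> B"
        using y inj that \<open>y \<in> vertices G\<close> by blast+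
      ultimately show "{x, f (h (g x))} \<in> edges G \<and> (x \<in> f ` A \<longrightarrow> f (h (g x)) \<in> f ` B) \<and>
          (x \<in> f ` B \<longrightarrow> f (h (g x)) \<in> f ` A) \<and> f (h (g (f (h (g x))))) \<noteq> x"
        using hy hom gf inj y by auto
    qed
  qed
  moreover have "f ` A \<inter> f ` B = {}" if "A \<subseteq> vertices G" "B \<subseteq> vertices G" "A \<inter> B = {}" for A B
    using that bij unfolding bij_betw_def by (metis image_empty inj_on_image_Int)
  moreover have "f ` A \<subseteq> vertices G" if "A \<subseteq> vertices G" for A
    using that bij unfolding bij_betw_def by blast
  ultimately show ?thesis
    using part unfolding cist_partition_def by simp
qed

lemma dominating_automorphism:
  assumes dom: "dominating G A" and bij: "bij_betw f (vertices G) (vertices G)" and A: "A \<subseteq> vertices G"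
    and hom: "\<And>x y. x \<in> vertices G \<Longrightarrow> y \<in> vertices G \<Longrightarrow> {x, y} \<in> edges G \<Longrightarrow> {f x, f y} \<in> edges G"
  shows "dominating G (f ` A)"
  unfolding dominating_def
proof
  fix x assume x: "x \<in> vertices G - f ` A"
  then obtain z where z: "z \<in> vertices G" "x = f z" using bij unfolding bij_betw_def by blast
  then obtain y where "y \<in> A" "{z, y} \<in> edges G" using x dom unfolding dominating_def by blast
  then show "\<exists>y\<in>f ` A. {x, y} \<in> edges G" using hom z A by blast
qed

section \<open>Linking edge sets of paths\<close>

text \<open>Here \<open>l\<close> counts edges, so the vertices are \<open>p 0\<close> to
  \<open>p l\<close>. Functions replace lists because the paths below are given by formulas for
  their \<open>t\<close>-th vertex.\<close>

definition path_edges :: "(nat \<Rightarrow> 'a) \<Rightarrow> nat \<Rightarrow> 'a set set" where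
  "path_edges p l = {{p t, p (Suc t)} |t. t < l}"

lemma line_graph_edge_iff:
  "{e, f} \<in> edges (line_graph G) \<longleftrightarrow> e \<in> edges G \<and> f \<in> edges G \<and> e \<noteq> f \<and> e \<inter> f \<noteq> {}"
  unfolding line_graph_def by (auto simp: doubleton_eq_iff)

lemma path_edges_eq_iff:
  assumes "inj_on p {..l}" "t < l" "s < l"
  shows "{p t, p (Suc t)} = {p s, p (Suc s)} \<longleftrightarrow> t = s"
  using assms by (auto simp: doubleton_eq_iff inj_on_eq_iff)

lemma Union_path_edges:
  assumes "0 < l" shows "\<Union>(path_edges p l) = p ` {..l}"
proof
  show "\<Union>(path_edges p l) \<subseteq> p ` {..l}" unfolding path_edges_def by auto
  have "p t \<in> \<Union>(path_edges p l)" if "t \<le> l" for t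
  proof (cases "t < l")
    case False
    then have "t = Suc (l - 1)" "l - 1 < l" using that assms by auto
    then show ?thesis unfolding path_edges_def by blast
  qed (auto simp: path_edges_def)
  then show "p ` {..l} \<subseteq> \<Union>(path_edges p l)" by auto
qed

text \<open>The edges of a path form a path in the line graph: the parent of an edge is its
  predecessor, and the rank is its position.\<close>

lemma rooted_path_edges:
  assumes "path_edges p l \<subseteq> edges G" "inj_on p {..l}" "0 < l"
  shows "rooted (line_graph G) (path_edges p l)"
proof -
  define idx where "idx e = (THE t. t < l \<and> e = {p t, p (Suc t)})" for e
  have idx: "idx {p t, p (Suc t)} = t" if "t < l" for t
    unfolding idx_def using path_edges_eq_iff[OF assms(2)] that by (intro the_equality) auto
  show ?thesis
    unfolding rooted_def
  proof (intro exI[of _ "{p 0, p (Suc 0)}"] exI[of _ "\<lambda>e. {p (idx e - 1), p (idx e)}"]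
      exI[of _ idx] conjI ballI)
    show "{p 0, p (Suc 0)} \<in> path_edges p l" using assms unfolding path_edges_def by auto
    fix e assume e: "e \<in> path_edges p l - {{p 0, p (Suc 0)}}"
    then obtain t where t: "t < l" "e = {p t, p (Suc t)}" unfolding path_edges_def by blast
    with e have "t \<noteq> 0" by auto
    then obtain s where s: "t = Suc s" by (cases t) auto
    have ie: "idx e = Suc s" using idx t s by simp
    have par: "{p (idx e - 1), p (idx e)} = {p s, p (Suc s)}" using ie by simp
    show *: "{p (idx e - 1), p (idx e)} \<in> path_edges p l"
      unfolding par path_edges_def using t s by auto
    show "idx {p (idx e - 1), p (idx e)} < idx e"
      unfolding par using idx[of s] t s ie by simp
    have "e \<noteq> {p s, p (Suc s)}" using path_edges_eq_iff[OF assms(2)] t s by auto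
    then show "{e, {p (idx e - 1), p (idx e)}} \<in> edges (line_graph G)"
      using * e assms(1) t s unfolding line_graph_edge_iff par by auto
  qed
qed

lemma dominating_path_edges:
  assumes "0 < l" "path_edges p l \<subseteq> edges G" "\<And>e. e \<in> edges G \<Longrightarrow> e \<inter> p ` {..l} \<noteq> {}"
  shows "dominating (line_graph G) (path_edges p l)"
  unfolding dominating_def
proof
  fix e assume "e \<in> vertices (line_graph G) - path_edges p l"
  then have e: "e \<in> edges G" "e \<notin> path_edges p l" by (auto simp: line_graph_def)
  then obtain f where "f \<in> path_edges p l" "e \<inter> f \<noteq> {}"
    using assms(3)[OF e(1)] Union_path_edges[OF assms(1), of p] by blast
  then show "\<exists>f\<in>path_edges p l. {e, f} \<in> edges (line_graph G)"
    using e assms(2) by (intro bexI[of _ f]) (auto simp: line_graph_edge_iff)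
qed

text \<open>Two edges that point at each other would have both their picked ends in common, so they
  could only be equal unless they pick the same end \<open>v\<close>. At each such \<open>v\<close> the cycle is broken by
  an edge that contains \<open>v\<close> but picks its other end.\<close>

lemma linked_pick:
  assumes AB: "A \<subseteq> edges G" "B \<subseteq> edges G" "A \<inter> B = {}" "\<And>e. e \<in> A \<union> B \<Longrightarrow> card e = 2"
    and pick: "\<And>e. e \<in> A \<union> B \<Longrightarrow> pick e \<in> e"
    and A: "\<And>e. e \<in> A \<Longrightarrow> \<exists>f\<in>B. pick e \<in> f" and B: "\<And>f. f \<in> B \<Longrightarrow> \<exists>e\<in>A. pick f \<in> e"
    and free: "\<And>e f. e \<in> A \<Longrightarrow> f \<in> B \<Longrightarrow> pick e = pick f \<Longrightarrow>
       \<exists>g\<in>A \<union> B. pick e \<in> g \<and> pick g \<noteq> pick e"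
  shows "linked (line_graph G) A B"
proof -
  define free_in where "free_in C e = (\<exists>g\<in>C. pick e \<in> g \<and> pick g \<noteq> pick e)" for C e
  \<comment> \<open>Among the edges of \<open>C\<close> at the picked vertex, one that picks its
    other end is preferred; this preference is what rules out swaps between edges with equal
    picks.\<close>
  define nb where "nb C e = (SOME g. g \<in> C \<and> pick e \<in> g \<and> (free_in C e \<longrightarrow> pick g \<noteq> pick e))" for C e
  have nb: "nb C e \<in> C \<and> pick e \<in> nb C e \<and> (free_in C e \<longrightarrow> pick (nb C e) \<noteq> pick e)"
    if "\<exists>g\<in>C. pick e \<in> g" for C e
    unfolding nb_def by (rule someI_ex) (use that in \<open>auto simp: free_in_def\<close>)
  define h where "h e = (if e \<in> A then nb B e else nb A e)" for e
  have hA: "h e \<in> B \<and> pick e \<in> h e \<and> (free_in B e \<longrightarrow> pick (h e) \<noteq> pick e)" if "e \<in> A" for e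
    using nb[OF A] that unfolding h_def by auto
  have hB: "h e \<in> A \<and> pick e \<in> h e \<and> (free_in A e \<longrightarrow> pick (h e) \<noteq> pick e)" if "e \<in> B" for e
    using nb[OF B] that AB(3) unfolding h_def by auto
  have no_swap: "False" if e: "e \<in> A" and f: "f \<in> B" and ef: "h e = f" "h f = e" for e f
  proof -
    have in_ef: "pick e \<in> e" "pick e \<in> f" "pick f \<in> e" "pick f \<in> f"
      using hA[OF e] hB[OF f] ef pick e f by auto
    have "e \<noteq> f" using e f AB(3) by blast
    have "pick e = pick f"
    proof (rule ccontr)
      assume *: "pick e \<noteq> pick f"
      have pair: "g = {pick e, pick f}" if "card g = 2" "pick e \<in> g" "pick f \<in> g" for g
        using that * by (auto simp: card_2_iff)
      have "card e = 2" "card f = 2" using AB(4) e f by auto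
      then show False using pair[of e] pair[of f] in_ef \<open>e \<noteq> f\<close> by argo
    qed
    moreover from this have "free_in A f \<or> free_in B e"
      using free[OF e f] unfolding free_in_def by auto
    ultimately show False using hA[OF e] hB[OF f] ef by auto
  qed
  show ?thesis
    unfolding linked_def
  proof (intro exI[of _ h] ballI)
    fix e assume "e \<in> A \<union> B"
    then show "{e, h e} \<in> edges (line_graph G) \<and>
        (e \<in> A \<longrightarrow> h e \<in> B) \<and> (e \<in> B \<longrightarrow> h e \<in> A) \<and> h (h e) \<noteq> e"
    proof
      assume e: "e \<in> A"
      then have "h e \<in> B" "e \<notin> B" "pick e \<in> h e" "pick e \<in> e" "h (h e) \<noteq> e" "e \<noteq> h e"
        using hA[OF e] AB(3) pick no_swap[OF e] by auto
      then show ?thesis using e AB(1,2) by (auto simp: line_graph_edge_iff)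
    next
      assume e: "e \<in> B"
      then have "h e \<in> A" "e \<notin> A" "pick e \<in> h e" "pick e \<in> e" "h (h e) \<noteq> e" "e \<noteq> h e"
        using hB[OF e] AB(3) pick no_swap[OF _ e, of "h e"] by auto
      then show ?thesis using e AB(1,2) by (auto simp: line_graph_edge_iff)
    qed
  qed
qed

text \<open>The choice of ends expressed by positions: \<open>a t\<close> and \<open>b s\<close>
  locate the ends picked by the \<open>t\<close>-th edge of \<open>p\<close> and the
  \<open>s\<close>-th edge of \<open>q\<close>.\<close>

lemma linked_paths_pick:
  assumes AB: "path_edges p l \<subseteq> edges G" "path_edges q m \<subseteq> edges G"
      "path_edges p l \<inter> path_edges q m = {}"
    and inj: "inj_on p {..l}" "inj_on q {..m}" and "0 < l" "0 < m"
    and a: "\<And>t. t < l \<Longrightarrow> a t \<in> {t, Suc t}" and b: "\<And>s. s < m \<Longrightarrow> b s \<in> {s, Suc s}"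
    and pq: "\<And>t. t < l \<Longrightarrow> p (a t) \<in> q ` {..m}" and qp: "\<And>s. s < m \<Longrightarrow> q (b s) \<in> p ` {..l}"
    and free: "\<And>t s. t < l \<Longrightarrow> s < m \<Longrightarrow> p (a t) = q (b s) \<Longrightarrow>
      (\<exists>t'<l. a t \<in> {t', Suc t'} \<and> a t' \<noteq> a t) \<or> (\<exists>s'<m. b s \<in> {s', Suc s'} \<and> b s' \<noteq> b s)"
  shows "linked (line_graph G) (path_edges p l) (path_edges q m)"
proof -
  define pick where "pick e = (if e \<in> path_edges p l
    then p (a (THE t. t < l \<and> e = {p t, p (Suc t)})) else q (b (THE s. s < m \<and> e = {q s, q (Suc s)})))" for e
  have "(THE t'. t' < l \<and> {p t, p (Suc t)} = {p t', p (Suc t')}) = t" if "t < l" for t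
    using path_edges_eq_iff[OF inj(1)] that by (intro the_equality) auto
  then have pick_p: "pick {p t, p (Suc t)} = p (a t)" if "t < l" for t
    using that unfolding pick_def path_edges_def by auto
  have "(THE t'. t' < m \<and> {q t, q (Suc t)} = {q t', q (Suc t')}) = t" if "t < m" for t
    using path_edges_eq_iff[OF inj(2)] that by (intro the_equality) auto
  moreover have "{q s, q (Suc s)} \<notin> path_edges p l" if "s < m" for s
    using that AB(3) unfolding path_edges_def by blast
  ultimately have pick_q: "pick {q s, q (Suc s)} = q (b s)" if "s < m" for s
    using that unfolding pick_def by auto
  have a_le: "a t \<le> l" if "t < l" for t using a[OF that] that by auto
  have b_le: "b s \<le> m" if "s < m" for s using b[OF that] that by auto
  show ?thesis
  proof (rule linked_pick[where pick = pick, OF AB])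
    fix e assume "e \<in> path_edges p l \<union> path_edges q m"
    then show "card e = 2"
      using inj unfolding path_edges_def by (auto simp: card_insert_if inj_on_eq_iff)
  next
    fix e assume "e \<in> path_edges p l \<union> path_edges q m"
    then show "pick e \<in> e"
      using pick_p pick_q a b unfolding path_edges_def by fastforce
  next
    fix e assume "e \<in> path_edges p l"
    then obtain t where "t < l" "e = {p t, p (Suc t)}" unfolding path_edges_def by blast
    then have "pick e \<in> \<Union>(path_edges q m)"
      using pick_p pq Union_path_edges[OF \<open>0 < m\<close>, of q] by simp
    then show "\<exists>f\<in>path_edges q m. pick e \<in> f" by blast
  next
    fix e assume "e \<in> path_edges q m"
    then obtain t where "t < m" "e = {q t, q (Suc t)}" unfolding path_edges_def by blast
    then have "pick e \<in> \<Union>(path_edges p l)"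
      using pick_q qp Union_path_edges[OF \<open>0 < l\<close>, of p] by simp
    then show "\<exists>f\<in>path_edges p l. pick e \<in> f" by blast
  next
    fix e f assume "e \<in> path_edges p l" "f \<in> path_edges q m" and eq: "pick e = pick f"
    then obtain t s where t: "t < l" "e = {p t, p (Suc t)}" and s: "s < m" "f = {q s, q (Suc s)}"
      unfolding path_edges_def by blast
    have v: "pick e = p (a t)" "pick e = q (b s)" using t s eq pick_p pick_q by auto
    have "p (a t) = q (b s)" using v by simp
    from free[OF t(1) s(1) this]
    show "\<exists>g\<in>path_edges p l \<union> path_edges q m. pick e \<in> g \<and> pick g \<noteq> pick e"
    proof (elim disjE exE conjE)
      fix t' assume t': "t' < l" "a t \<in> {t', Suc t'}" "a t' \<noteq> a t"
      then have "pick {p t', p (Suc t')} \<noteq> pick e"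
        using pick_p v(1) inj(1) a_le t by (simp add: inj_on_eq_iff)
      moreover have "pick e \<in> {p t', p (Suc t')}" "{p t', p (Suc t')} \<in> path_edges p l \<union> path_edges q m"
        using t' v(1) unfolding path_edges_def by auto
      ultimately show ?thesis by (intro bexI conjI)
    next
      fix s' assume s': "s' < m" "b s \<in> {s', Suc s'}" "b s' \<noteq> b s"
      then have "pick {q s', q (Suc s')} \<noteq> pick e"
        using pick_q v(2) inj(2) b_le s by (simp add: inj_on_eq_iff)
      moreover have "pick e \<in> {q s', q (Suc s')}" "{q s', q (Suc s')} \<in> path_edges p l \<union> path_edges q m"
        using s' v(2) unfolding path_edges_def by auto
      ultimately show ?thesis by (intro bexI conjI)
    qed
  qed
qed

text \<open>Each path is rooted at the vertex that the other one misses, and every edge picks its end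
  farther from the root.\<close>

lemma linked_paths_no_common_end:
  assumes AB: "path_edges p l \<subseteq> edges G" "path_edges q m \<subseteq> edges G"
      "path_edges p l \<inter> path_edges q m = {}"
    and inj: "inj_on p {..l}" "inj_on q {..m}" and pos: "0 < l" "0 < m"
    and p: "p ` {..l} = N - {x}" and q: "q ` {..m} = N - {y}" and xy: "x \<in> N" "y \<in> N" "x \<noteq> y"
    and ends: "{p 0, p l} \<inter> {q 0, q m} = {}"
  shows "linked (line_graph G) (path_edges p l) (path_edges q m)"
proof -
  have "y \<in> p ` {..l}" "x \<in> q ` {..m}" using p q xy by auto
  then obtain i j where i: "i \<le> l" "p i = y" and j: "j \<le> m" "q j = x" by auto
  \<comment> \<open>Edges before position \<open>i\<close> of the root pick their earlier end, the
    others their later end. Thus \<open>p i = y\<close>, which \<open>q\<close> misses, is never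
    picked; likewise \<open>x\<close> on \<open>q\<close>.\<close>
  define a where "a t = (if t < i then t else Suc t)" for t
  define b where "b t = (if t < j then t else Suc t)" for t
  show ?thesis
  proof (rule linked_paths_pick[where a = a and b = b, OF AB inj pos])
    fix t assume t: "t < l"
    show "a t \<in> {t, Suc t}" by (simp add: a_def)
    have "a t \<le> l" "a t \<noteq> i" using t by (auto simp: a_def)
    then have "p (a t) \<noteq> y" "p (a t) \<in> p ` {..l}" using i inj(1) by (auto simp: inj_on_eq_iff)
    then show "p (a t) \<in> q ` {..m}" using p q by auto
  next
    fix t assume t: "t < m"
    show "b t \<in> {t, Suc t}" by (simp add: b_def)
    have "b t \<le> m" "b t \<noteq> j" using t by (auto simp: b_def)
    then have "q (b t) \<noteq> x" "q (b t) \<in> q ` {..m}" using j inj(2) by (auto simp: inj_on_eq_iff)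
    then show "q (b t) \<in> p ` {..l}" using p q by auto
  next
    fix t s assume t: "t < l" and s: "s < m" and eq: "p (a t) = q (b s)"
    have "\<not> (a t \<in> {0, l} \<and> b s \<in> {0, m})"
    proof (rule notI, elim conjE)
      assume "a t \<in> {0, l}" "b s \<in> {0, m}"
      then have "p (a t) \<in> {p 0, p l}" "q (b s) \<in> {q 0, q m}" by auto
      then show False using ends eq by (metis IntI empty_iff)
    qed
    \<comment> \<open>A picked inner vertex also lies on the next edge away from the root, and that
      edge picks its other end. Only the ends of a path lack such an edge.\<close>
    moreover have "\<exists>t'<l. a t \<in> {t', Suc t'} \<and> a t' \<noteq> a t" if "a t \<notin> {0, l}"
      using that t i by (intro exI[of _ "if t < i then t - 1 else Suc t"]) (auto simp: a_def)
    moreover have "\<exists>s'<m. b s \<in> {s', Suc s'} \<and> b s' \<noteq> b s" if "b s \<notin> {0, m}"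
      using that s j by (intro exI[of _ "if s < j then s - 1 else Suc s"]) (auto simp: b_def)
    ultimately show "(\<exists>t'<l. a t \<in> {t', Suc t'} \<and> a t' \<noteq> a t) \<or> (\<exists>s'<m. b s \<in> {s', Suc s'} \<and> b s' \<noteq> b s)"
      by blast
  qed
qed

text \<open>If \<open>p 0\<close> is also an end of \<open>q\<close>, the first edge of \<open>p\<close> picks \<open>p 1\<close> instead.\<close>

lemma linked_paths_common_end:
  assumes AB: "path_edges p l \<subseteq> edges G" "path_edges q m \<subseteq> edges G"
      "path_edges p l \<inter> path_edges q m = {}"
    and inj: "inj_on p {..l}" "inj_on q {..m}" and pos: "0 < l" "0 < m"
    and p: "p ` {..l} = N - {x}" and q: "q ` {..m} = N - {y}" and xy: "x \<in> N" "y \<in> N" "x \<noteq> y"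
    and ends: "{p 1, p l} \<inter> {q 0, q m} = {}" and y: "y \<noteq> p 0" "y \<noteq> p 1"
  shows "linked (line_graph G) (path_edges p l) (path_edges q m)"
proof -
  have "y \<in> p ` {..l}" "x \<in> q ` {..m}" using p q xy by auto
  then obtain i j where i: "i \<le> l" "p i = y" and j: "j \<le> m" "q j = x" by auto
  have "2 \<le> i"
  proof (rule ccontr)
    assume "\<not> 2 \<le> i"
    then have "i = 0 \<or> i = 1" by auto
    then show False using i y by auto
  qed
  \<comment> \<open>Edge \<open>0\<close> now picks position \<open>1\<close>, as does edge
    \<open>1\<close> because \<open>2 \<le> i\<close>. So position \<open>0\<close> is never
    picked.\<close>
  define a where "a t = (if t < i \<and> t \<noteq> 0 then t else Suc t)" for t
  define b where "b t = (if t < j then t else Suc t)" for t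
  show ?thesis
  proof (rule linked_paths_pick[where a = a and b = b, OF AB inj pos])
    fix t assume t: "t < l"
    show "a t \<in> {t, Suc t}" by (simp add: a_def)
    have "a t \<le> l" "a t \<noteq> i" using t \<open>2 \<le> i\<close> by (auto simp: a_def)
    then have "p (a t) \<noteq> y" "p (a t) \<in> p ` {..l}" using i inj(1) by (auto simp: inj_on_eq_iff)
    then show "p (a t) \<in> q ` {..m}" using p q by auto
  next
    fix t assume t: "t < m"
    show "b t \<in> {t, Suc t}" by (simp add: b_def)
    have "b t \<le> m" "b t \<noteq> j" using t by (auto simp: b_def)
    then have "q (b t) \<noteq> x" "q (b t) \<in> q ` {..m}" using j inj(2) by (auto simp: inj_on_eq_iff)
    then show "q (b t) \<in> p ` {..l}" using p q by auto
  next
    fix t s assume t: "t < l" and s: "s < m" and eq: "p (a t) = q (b s)"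
    \<comment> \<open>Both edges at position \<open>1\<close> pick it, so it takes over the role of
      the end \<open>0\<close>.\<close>
    have "\<not> (a t \<in> {1, l} \<and> b s \<in> {0, m})"
    proof (rule notI, elim conjE)
      assume "a t \<in> {1, l}" "b s \<in> {0, m}"
      then have "p (a t) \<in> {p 1, p l}" "q (b s) \<in> {q 0, q m}" by auto
      then show False using ends eq by (metis IntI empty_iff)
    qed
    moreover have "\<exists>t'<l. a t \<in> {t', Suc t'} \<and> a t' \<noteq> a t" if "a t \<notin> {1, l}"
      using that t i by (intro exI[of _ "if t < i then t - 1 else Suc t"]) (auto simp: a_def split: if_splits)
    moreover have "\<exists>s'<m. b s \<in> {s', Suc s'} \<and> b s' \<noteq> b s" if "b s \<notin> {0, m}"
      using that s j by (intro exI[of _ "if s < j then s - 1 else Suc s"]) (auto simp: b_def)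
    ultimately show "(\<exists>t'<l. a t \<in> {t', Suc t'} \<and> a t' \<noteq> a t) \<or> (\<exists>s'<m. b s \<in> {s', Suc s'} \<and> b s' \<noteq> b s)"
      by blast
  qed
qed

section \<open>Line graphs of complete graphs\<close>

abbreviation (input) line_complete :: "nat \<Rightarrow> nat set sgraph" where
  "line_complete n \<equiv> line_graph (complete_graph n)"

text \<open>Some partition into classes lives entirely outside \<open>X\<close>; edges outside \<open>X\<close> may remain uncovered.\<close>

definition avoidable :: "nat \<Rightarrow> nat \<Rightarrow> nat set set \<Rightarrow> bool" where
  "avoidable n k X \<longleftrightarrow> (\<exists>V. cist_partition (line_complete n) k V \<and>
     (\<forall>i<k. dominating (line_complete n) (V i) \<and> V i \<inter> X = {}))"

lemma vertices_line_complete: "vertices (line_complete n) = {e. e \<subseteq> {..<n} \<and> card e = 2}"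
  by (simp add: line_graph_def complete_graph_def)

lemma finite_vertices_line_complete: "finite (vertices (line_complete n))"
  unfolding vertices_line_complete by (rule finite_subset[of _ "Pow {..<n}"]) auto

text \<open>Permitting a subset \<open>Y\<close> of \<open>X\<close> lets one maximal deleted set
  cover all smaller ones.\<close>

lemma has_cists_delete:
  assumes "avoidable n k X" "0 < k" "Y \<subseteq> X"
  shows "has_cists (delete_vertices (line_complete n) Y) k"
proof -
  obtain V where V: "cist_partition (line_complete n) k V"
    "\<And>i. i < k \<Longrightarrow> dominating (line_complete n) (V i)" "\<And>i. i < k \<Longrightarrow> V i \<inter> X = {}"
    using assms(1) unfolding avoidable_def by auto
  have "V i \<subseteq> vertices (line_complete n) - Y" if "i < k" for i
    using V(1) V(3)[OF that] that assms(3) unfolding cist_partition_def by blast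
  then show ?thesis
    unfolding delete_vertices_def
    using has_cists_induced[OF finite_vertices_line_complete assms(2) V(1,2)] by blast
qed

lemma avoidable_image:
  assumes "avoidable n k X" and bij: "bij_betw f {..<n} {..<n}" and X: "X \<subseteq> vertices (line_complete n)"
  shows "avoidable n k ((`) f ` X)"
proof -
  obtain V where V: "cist_partition (line_complete n) k V"
    "\<And>i. i < k \<Longrightarrow> dominating (line_complete n) (V i)" "\<And>i. i < k \<Longrightarrow> V i \<inter> X = {}"
    using assms(1) unfolding avoidable_def by auto
  have sub: "V i \<subseteq> vertices (line_complete n)" if "i < k" for i
    using V(1) that unfolding cist_partition_def by blast
  have inj: "inj_on f {..<n}" and im: "f ` {..<n} = {..<n}" using bij unfolding bij_betw_def by auto
  have "f ` e \<in> vertices (line_complete n)" if "e \<in> vertices (line_complete n)" for e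
    using that im inj unfolding vertices_line_complete
    by (auto simp: card_image inj_on_subset)
  then have maps: "(`) f ` vertices (line_complete n) \<subseteq> vertices (line_complete n)" by blast
  have inj': "inj_on ((`) f) (vertices (line_complete n))"
    using inj unfolding vertices_line_complete
    by (intro inj_onI) (simp add: inj_on_image_eq_iff)
  have bij': "bij_betw ((`) f) (vertices (line_complete n)) (vertices (line_complete n))"
    unfolding bij_betw_def
    using inj' endo_inj_surj[OF finite_vertices_line_complete maps inj'] by blast
  have hom: "{f ` x, f ` y} \<in> edges (line_complete n)"
    if "x \<in> vertices (line_complete n)" "y \<in> vertices (line_complete n)"
      "{x, y} \<in> edges (line_complete n)" for x y
  proof -
    have "f ` x \<noteq> f ` y" using that inj' by (auto simp: line_graph_edge_iff inj_on_eq_iff)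
    moreover have "f ` x \<in> edges (complete_graph n)" "f ` y \<in> edges (complete_graph n)"
      using that maps by (auto simp: line_graph_def)
    moreover have "f ` x \<inter> f ` y \<noteq> {}" using that by (auto simp: line_graph_edge_iff)
    ultimately show ?thesis by (simp add: line_graph_edge_iff)
  qed
  have "(`) f ` V i \<inter> (`) f ` X = {}" if "i < k" for i
    using inj_on_image_Int[OF inj' sub[OF that] X] V(3)[OF that] by simp
  moreover have "dominating (line_complete n) ((`) f ` V i)" if "i < k" for i
    using dominating_automorphism[OF V(2)[OF that] bij' sub[OF that] hom] by blast
  moreover have "cist_partition (line_complete n) k (\<lambda>i. (`) f ` V i)"
    using cist_partition_automorphism[OF V(1) bij' hom] by blast
  ultimately show ?thesis unfolding avoidable_def by (intro exI[of _ "\<lambda>i. (`) f ` V i"]) simp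
qed

lemma path_edges_complete:
  assumes "inj_on p {..l}" "p ` {..l} \<subseteq> {..<n}"
  shows "path_edges p l \<subseteq> edges (complete_graph n)"
proof
  fix e assume "e \<in> path_edges p l"
  then obtain t where t: "t < l" "e = {p t, p (Suc t)}" unfolding path_edges_def by blast
  then have "p t \<noteq> p (Suc t)" using assms(1) by (simp add: inj_on_eq_iff)
  moreover have "p t \<in> {..<n}" "p (Suc t) \<in> {..<n}" 
    using t(1) by (intro subsetD[OF assms(2)] imageI; simp)+
  ultimately show "e \<in> edges (complete_graph n)"
    using t by (auto simp: complete_graph_def card_insert_if)
qed

text \<open>Each path misses at most the vertex \<open>x i\<close>, so every edge of
  \<open>K_n\<close> has an end on it; this gives domination. The lengths may differ, as they do for
  \<open>n = 4\<close>.\<close>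

lemma avoidable_path_system:
  assumes pos: "\<And>i. i < k \<Longrightarrow> 0 < l i" and inj: "\<And>i. i < k \<Longrightarrow> inj_on (P i) {..l i}"
    and range: "\<And>i. i < k \<Longrightarrow> P i ` {..l i} \<subseteq> {..<n}"
    and most: "\<And>i. i < k \<Longrightarrow> {..<n} - {x i} \<subseteq> P i ` {..l i}"
    and X: "\<And>i. i < k \<Longrightarrow> path_edges (P i) (l i) \<inter> X = {}"
    and disj: "\<And>i j. i < j \<Longrightarrow> j < k \<Longrightarrow> path_edges (P i) (l i) \<inter> path_edges (P j) (l j) = {}"
    and link: "\<And>i j. i < j \<Longrightarrow> j < k \<Longrightarrow>
      linked (line_complete n) (path_edges (P i) (l i)) (path_edges (P j) (l j))"
  shows "avoidable n k X"
proof -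
  let ?V = "\<lambda>i. path_edges (P i) (l i)"
  have sub: "?V i \<subseteq> edges (complete_graph n)" if "i < k" for i
    using path_edges_complete[OF inj[OF that] range[OF that]] .
  have "?V i \<inter> ?V j = {} \<and> linked (line_complete n) (?V i) (?V j)" if "i < k" "j < k" "i \<noteq> j" for i j
  proof (cases "i < j")
    case True
    then show ?thesis using disj link that by blast
  next
    case False
    then have "j < i" using that by simp
    then show ?thesis using disj[of j i] linked_sym[OF link[of j i]] that by blast
  qed
  moreover have "?V i \<subseteq> vertices (line_complete n) \<and> rooted (line_complete n) (?V i)" if "i < k" for i
    using rooted_path_edges[OF sub[OF that] inj[OF that] pos[OF that]] sub[OF that]
    by (simp add: line_graph_def)
  ultimately have "cist_partition (line_complete n) k ?V" unfolding cist_partition_def by blast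
  moreover have "dominating (line_complete n) (?V i)" if "i < k" for i
  proof (rule dominating_path_edges[OF pos[OF that] sub[OF that]])
    fix e assume "e \<in> edges (complete_graph n)"
    then obtain a b where "e = {a, b}" "a \<noteq> b" "a < n" "b < n"
      by (auto simp: complete_graph_def card_2_iff)
    then show "e \<inter> P i ` {..l i} \<noteq> {}" using most[OF that] by (cases "a = x i") auto
  qed
  ultimately show ?thesis using X unfolding avoidable_def by (intro exI[of _ ?V]) blast
qed

text \<open>By counting, each path covers everything except \<open>x i\<close>, so it can be rooted
  at every other missed vertex. The alternatives for the ends match the two linking lemmas.\<close>

lemma avoidable_almost_hamiltonian_paths:
  assumes l: "0 < l" "n = l + 2" and inj: "\<And>i. i < k \<Longrightarrow> inj_on (P i) {..l}"
    and range: "\<And>i t. i < k \<Longrightarrow> t \<le> l \<Longrightarrow> P i t < n \<and> P i t \<noteq> x i"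
    and x: "\<And>i. i < k \<Longrightarrow> x i < n" "inj_on x {..<k}"
    and X: "\<And>i. i < k \<Longrightarrow> path_edges (P i) l \<inter> X = {}"
    and disj: "\<And>i j. i < j \<Longrightarrow> j < k \<Longrightarrow> path_edges (P i) l \<inter> path_edges (P j) l = {}"
    and ends: "\<And>i j. i < j \<Longrightarrow> j < k \<Longrightarrow> {P i 0, P i l} \<inter> {P j 0, P j l} = {} \<or>
      {P i 1, P i l} \<inter> {P j 0, P j l} = {} \<and> x j \<notin> {P i 0, P i 1}"
  shows "avoidable n k X"
proof -
  have im: "P i ` {..l} = {..<n} - {x i}" if "i < k" for i
    using range[OF that] x(1)[OF that] card_image[OF inj[OF that]] l
    by (intro card_subset_eq) auto
  have sub: "path_edges (P i) l \<subseteq> edges (complete_graph n)" if "i < k" for i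
    using path_edges_complete[OF inj[OF that]] im[OF that] by blast
  show ?thesis
  proof (rule avoidable_path_system[where P = P and l = "\<lambda>_. l" and x = x])
    fix i j assume ij: "i < j" "j < k"
    then have i: "i < k" by simp
    have "x i \<noteq> x j" using x(2) ij by (auto simp: inj_on_eq_iff)
    then show "linked (line_complete n) (path_edges (P i) l) (path_edges (P j) l)"
      using ends[OF ij] linked_paths_no_common_end[OF sub[OF i] sub[OF ij(2)] disj[OF ij] inj[OF i]
          inj[OF ij(2)] l(1) l(1) im[OF i] im[OF ij(2)]]
        linked_paths_common_end[OF sub[OF i] sub[OF ij(2)] disj[OF ij] inj[OF i]
          inj[OF ij(2)] l(1) l(1) im[OF i] im[OF ij(2)]] x(1)[OF i] x(1)[OF ij(2)]
      by auto
  qed (use l inj im X disj in auto)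
qed

section \<open>Complete graphs of even order\<close>

text \<open>The zigzag \<open>i + k, i + k + 1, i + k - 1, \<dots>, i + 1\<close> modulo \<open>2k\<close>, which stops just before \<open>i\<close>;
  the sums of consecutive vertices are \<open>2i\<close> and \<open>2i + 1\<close>.\<close>

definition even_path :: "nat \<Rightarrow> nat \<Rightarrow> nat \<Rightarrow> nat" where
  "even_path k i t = (if even t then i + k - t div 2
     else if i + Suc (t div 2) < k then i + k + Suc (t div 2) else i + Suc (t div 2) - k)"

lemma even_path_simps:
  "even_path k i (2 * s) = i + k - s"
  "even_path k i (Suc (2 * s)) = (if i + Suc s < k then i + k + Suc s else i + Suc s - k)"
  unfolding even_path_def by simp_all

lemma nat_parity_cases:
  fixes t :: nat
  obtains s where "t = 2 * s" | s where "t = Suc (2 * s)"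
  by (metis evenE oddE Suc_eq_plus1)

lemma even_path_range:
  assumes "i < k" "t \<le> 2 * k - 2"
  shows "even_path k i t < 2 * k \<and> even_path k i t \<noteq> i"
  by (cases t rule: nat_parity_cases) (use assms in \<open>auto simp: even_path_simps\<close>)

lemma inj_even_path:
  assumes "i < k" shows "inj_on (even_path k i) {..2 * k - 2}"
proof (rule inj_onI)
  fix t u assume "t \<in> {..2 * k - 2}" "u \<in> {..2 * k - 2}" "even_path k i t = even_path k i u"
  then show "t = u"
    using assms
    by (cases t rule: nat_parity_cases; cases u rule: nat_parity_cases)
      (auto simp: even_path_simps split: if_splits)
qed

text \<open>These are the values below \<open>4k\<close> with residue \<open>2i\<close> or
  \<open>2i + 1\<close> modulo \<open>2k\<close>. For different \<open>i\<close> the residues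
  differ, so the sum of an edge identifies its path.\<close>

lemma even_path_sum:
  assumes "i < k" "{a, b} \<in> path_edges (even_path k i) (2 * k - 2)"
  shows "a + b \<in> {2 * i, 2 * i + 1, 2 * i + 2 * k, 2 * i + 2 * k + 1}"
proof -
  obtain t where t: "t < 2 * k - 2" "{a, b} = {even_path k i t, even_path k i (Suc t)}"
    using assms(2) unfolding path_edges_def by blast
  then have "a + b = even_path k i t + even_path k i (Suc t)" by (auto simp: doubleton_eq_iff)
  moreover have "even_path k i t + even_path k i (Suc t)
      \<in> {2 * i, 2 * i + 1, 2 * i + 2 * k, 2 * i + 2 * k + 1}"
  proof (cases t rule: nat_parity_cases)
    case (1 s)
    then show ?thesis using t(1) assms(1) by (auto simp: even_path_simps)
  next
    case (2 s)
    have "Suc t = 2 * Suc s" using 2 by simp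
    then show ?thesis using 2 t(1) assms(1) by (simp only: even_path_simps) auto
  qed
  ultimately show ?thesis by simp
qed

text \<open>Continuing the zigzag to \<open>i\<close> would add the edge \<open>{i, i + 1}\<close>;
  the edges omitted in this way form the path \<open>0, 1, \<dots>, k\<close>.\<close>

lemma avoidable_even:
  assumes "3 \<le> k"
  shows "avoidable (2 * k) k {{t, Suc t} |t. t < k}"
proof (rule avoidable_almost_hamiltonian_paths[where P = "even_path k" and x = id and l = "2 * k - 2"])
  fix i assume i: "i < k"
  show "path_edges (even_path k i) (2 * k - 2) \<inter> {{t, Suc t} |t. t < k} = {}"
  proof (rule ccontr)
    assume "path_edges (even_path k i) (2 * k - 2) \<inter> {{t, Suc t} |t. t < k} \<noteq> {}"
    then obtain t where t: "t < k" and e: "{t, Suc t} \<in> path_edges (even_path k i) (2 * k - 2)"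
      by blast
    \<comment> \<open>The sum \<open>2t + 1\<close> points to path \<open>i = t\<close>, but that
      path misses the vertex \<open>i\<close>.\<close>
    then have "t = i" using even_path_sum[OF i e] i by auto
    moreover have "t \<in> even_path k i ` {..2 * k - 2}"
      using e unfolding path_edges_def by (auto simp: doubleton_eq_iff)
    ultimately show False using even_path_range[OF i] by (metis atMost_iff imageE)
  qed
next
  fix i j assume ij: "i < j" "j < k"
  show "path_edges (even_path k i) (2 * k - 2) \<inter> path_edges (even_path k j) (2 * k - 2) = {}"
  proof (rule ccontr)
    assume "\<not> ?thesis"
    then obtain a b where ab: "{a, b} \<in> path_edges (even_path k i) (2 * k - 2)"
      "{a, b} \<in> path_edges (even_path k j) (2 * k - 2)"
      unfolding path_edges_def by blast
    show False using even_path_sum[OF _ ab(1)] even_path_sum[OF ij(2) ab(2)] ij by (auto; presburger)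
  qed
  have ends: "even_path k i 0 = i + k" "even_path k i (2 * k - 2) = i + 1" for i
  proof -
    have "2 * k - 2 = 2 * (k - 1)" by simp
    then show "even_path k i (2 * k - 2) = i + 1"
      using assms by (simp only: even_path_simps)
  qed (simp add: even_path_def)
  have "even_path k i 1 = (if i + 1 < k then i + k + 1 else i + 1 - k)"
    by (simp add: even_path_def)
  \<comment> \<open>Only \<open>i = 0\<close> and \<open>j = k - 1\<close> share an end, namely
    \<open>k = even_path k 0 0\<close>. There the second alternative holds, using
    \<open>3 \<le> k\<close>.\<close>
  then show "{even_path k i 0, even_path k i (2 * k - 2)} \<inter>
      {even_path k j 0, even_path k j (2 * k - 2)} = {} \<or>
      {even_path k i 1, even_path k i (2 * k - 2)} \<inter>
      {even_path k j 0, even_path k j (2 * k - 2)} = {} \<and>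
      id j \<notin> {even_path k i 0, even_path k i 1}"
    using ij assms unfolding ends by auto
qed (use assms inj_even_path even_path_range in auto)

section \<open>Complete graphs of odd order\<close>

text \<open>The vertex \<open>2m\<close> plays the role of \<open>\<infinity>\<close>. The path is
  \<open>i + m, i - 1, i + m + 1, i - 2, \<dots>, \<infinity>, \<dots>, i + m - 2, i + 1, i + m - 1\<close> modulo \<open>2m\<close>.\<close>

definition odd_path :: "nat \<Rightarrow> nat \<Rightarrow> nat \<Rightarrow> nat" where
  "odd_path m i t =
     (if t = m then 2 * m
      else if t < m then
        (if even t then (if i + t div 2 < m then i + m + t div 2 else i + t div 2 - m)
         else (if t div 2 < i then i - Suc (t div 2) else i + 2 * m - Suc (t div 2)))
      else (if even t then i + m - t div 2 else i + t div 2))"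

lemma odd_path_simps:
  "odd_path m i (2 * s) = (if 2 * s = m then 2 * m else if 2 * s < m then
     (if i + s < m then i + m + s else i + s - m) else i + m - s)"
  "odd_path m i (Suc (2 * s)) = (if Suc (2 * s) = m then 2 * m else if Suc (2 * s) < m then
     (if s < i then i - Suc s else i + 2 * m - Suc s) else i + s)"
  unfolding odd_path_def by simp_all

lemma odd_path_range:
  assumes "i < m" "t \<le> 2 * m - 1"
  shows "odd_path m i t < 2 * m + 1 \<and> odd_path m i t \<noteq> i"
  by (cases t rule: nat_parity_cases) (use assms in \<open>auto simp: odd_path_simps\<close>)

lemma inj_odd_path:
  assumes "i < m" shows "inj_on (odd_path m i) {..2 * m - 1}"
proof (rule inj_onI)
  fix t u assume "t \<in> {..2 * m - 1}" "u \<in> {..2 * m - 1}" "odd_path m i t = odd_path m i u"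
  then show "t = u"
    using assms
    by (cases t rule: nat_parity_cases; cases u rule: nat_parity_cases)
      (auto simp: odd_path_simps split: if_splits)
qed

text \<open>The residues of \<open>2i + m\<close> and \<open>2i + m - 1\<close> modulo \<open>2m\<close> among the sums of two vertices. Counting an edge
  \<open>{a, \<infinity>}\<close> as \<open>2a\<close>, these residues identify the path that contains a given edge.\<close>

definition sum_class :: "nat \<Rightarrow> nat \<Rightarrow> nat set" where
  "sum_class m i = {z. z = 2 * i + m \<or> z = 2 * i + 3 * m \<or> z + m = 2 * i \<or>
     z + 1 = 2 * i + m \<or> z + 1 = 2 * i + 3 * m \<or> z + 1 + m = 2 * i}"

definition pair_sum :: "nat \<Rightarrow> nat set \<Rightarrow> nat" where
  "pair_sum m e = (if 2 * m \<in> e then 2 * (\<Sum>e - 2 * m) else \<Sum>e)"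

lemma pair_sum_doubleton:
  "a < 2 * m \<Longrightarrow> pair_sum m {a, 2 * m} = 2 * a"
  "a \<noteq> b \<Longrightarrow> a < 2 * m \<Longrightarrow> b < 2 * m \<Longrightarrow> pair_sum m {a, b} = a + b"
  unfolding pair_sum_def by auto

lemma odd_path_lt:
  assumes "i < m" "t \<le> 2 * m - 1" "t \<noteq> m"
  shows "odd_path m i t < 2 * m"
  by (cases t rule: nat_parity_cases) (use assms in \<open>auto simp: odd_path_simps\<close>)

lemma odd_path_add_Suc:
  assumes "i < m" "t < 2 * m - 1" "t \<noteq> m" "Suc t \<noteq> m"
  shows "odd_path m i t + odd_path m i (Suc t) \<in> sum_class m i"
proof (cases t rule: nat_parity_cases)
  case (1 s)
  then show ?thesis
    using assms by (cases "2 * s < m") (auto simp: odd_path_simps sum_class_def)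
next
  case (2 s)
  have s: "Suc t = 2 * Suc s" using 2 by simp
  then have *: "odd_path m i (Suc t) = (if 2 * Suc s < m then
     (if i + Suc s < m then i + m + Suc s else i + Suc s - m) else i + m - Suc s)"
    using assms(4) by (simp only: odd_path_simps if_False)
  show ?thesis
    unfolding * using assms 2 by (cases "Suc (2 * s) < m") (auto simp: odd_path_simps sum_class_def)
qed

text \<open>The two neighbours of infinity differ by \<open>m\<close>, so their doubles agree modulo
  \<open>2m\<close>. They solve \<open>2a = c\<close> for one residue \<open>c\<close> of the class,
  hence pair with no other vertex to a sum \<open>c\<close>.\<close>

lemma odd_path_double:
  assumes "i < m" "Suc t = m \<or> t = Suc m" "t \<le> 2 * m - 1"
  shows "2 * odd_path m i t \<in> sum_class m i"
  by (cases t rule: nat_parity_cases) (use assms in \<open>auto simp: odd_path_simps sum_class_def\<close>)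

lemma odd_path_sum:
  assumes "i < m" "e \<in> path_edges (odd_path m i) (2 * m - 1)"
  shows "pair_sum m e \<in> sum_class m i"
proof -
  obtain t where t: "t < 2 * m - 1" "e = {odd_path m i t, odd_path m i (Suc t)}"
    using assms(2) unfolding path_edges_def by blast
  have ne: "odd_path m i t \<noteq> odd_path m i (Suc t)"
    using inj_odd_path[OF assms(1)] t(1) by (simp add: inj_on_eq_iff)
  have m: "odd_path m i m = 2 * m" by (simp add: odd_path_def)
  consider "t = m" | "Suc t = m" | "t \<noteq> m" "Suc t \<noteq> m" by blast
  then show ?thesis
  proof cases
    case 1
    then have "e = {odd_path m i (Suc t), 2 * m}" using t(2) m by (simp add: insert_commute)
    then show ?thesis
      using pair_sum_doubleton(1)[OF odd_path_lt[OF assms(1), of "Suc t"]]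
        odd_path_double[OF assms(1), of "Suc t"] 1 t(1) by simp
  next
    case 2
    then have "e = {odd_path m i t, 2 * m}" using t(2) m by simp
    then show ?thesis
      using pair_sum_doubleton(1)[OF odd_path_lt[OF assms(1), of t]]
        odd_path_double[OF assms(1), of t] 2 t(1) by simp
  next
    case 3
    then show ?thesis
      using pair_sum_doubleton(2)[OF ne odd_path_lt[OF assms(1)] odd_path_lt[OF assms(1)]]
        odd_path_add_Suc[OF assms(1) t(1)] t by simp
  qed
qed

text \<open>For \<open>i < m\<close> the residues \<open>2i + m\<close> and
  \<open>2i + m - 1\<close> run once through all residues modulo \<open>2m\<close>.\<close>

lemma sum_class_disjoint:
  assumes "i < m" "j < m" "z \<in> sum_class m i" "z \<in> sum_class m j"
  shows "i = j"
  using assms unfolding sum_class_def by (auto; presburger)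

text \<open>The edges at \<open>y\<close> of the cycle from which \<open>odd_path m y\<close> arises are \<open>{y, y + m}\<close> and
  \<open>{y, y + m - 1}\<close>; for \<open>y < m\<close> they form this path together with the edge \<open>{0, m - 1}\<close>.\<close>

definition last_path :: "nat \<Rightarrow> nat \<Rightarrow> nat" where
  "last_path m t = (if even t then 2 * m - 1 - t div 2 else m - 1 - t div 2)"

lemma last_path_simps:
  "last_path m (2 * s) = 2 * m - 1 - s" "last_path m (Suc (2 * s)) = m - 1 - s"
  unfolding last_path_def by simp_all

lemma inj_last_path: "inj_on (last_path m) {..2 * m - 1}"
proof (rule inj_onI)
  fix t u assume "t \<in> {..2 * m - 1}" "u \<in> {..2 * m - 1}" "last_path m t = last_path m u"
  then show "t = u"
    by (cases t rule: nat_parity_cases; cases u rule: nat_parity_cases) (auto simp: last_path_simps)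
qed

text \<open>The two kinds alternate along the path. The bound \<open>0 < y\<close> in the second
  leaves out \<open>{0, m - 1}\<close>, the edge kept for deletion.\<close>

lemma last_path_edges:
  assumes "0 < m" "e \<in> path_edges (last_path m) (2 * m - 1)"
  obtains y where "y < m" "e = {y, y + m}" | y where "0 < y" "y < m" "e = {y, y + m - 1}"
proof -
  obtain t where t: "t < 2 * m - 1" "e = {last_path m t, last_path m (Suc t)}"
    using assms(2) unfolding path_edges_def by blast
  show thesis
  proof (cases t rule: nat_parity_cases)
    case (1 s)
    then have "e = {m - 1 - s, m - 1 - s + m}" "m - 1 - s < m"
      using t assms(1) by (auto simp: last_path_simps insert_commute)
    then show thesis using that(1) by blast
  next
    case (2 s)
    have "Suc t = 2 * Suc s" using 2 by simp
    then have "last_path m (Suc t) = m - 1 - s + m - 1"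
      using 2 t(1) by (simp only: last_path_simps)
    then have "e = {m - 1 - s, m - 1 - s + m - 1}" "m - 1 - s < m" "0 < m - 1 - s"
      using 2 t assms(1) by (auto simp: last_path_simps)
    then show thesis using that(2) by blast
  qed
qed

text \<open>The sum \<open>y + z\<close> belongs to the class of \<open>y\<close> alone, and path
  \<open>y\<close> does not visit \<open>y\<close>.\<close>

lemma odd_path_avoids:
  assumes "i < m" "y < m" "z = y + m \<or> z = y + m - 1" "y \<noteq> z"
  shows "{y, z} \<notin> path_edges (odd_path m i) (2 * m - 1)"
proof
  assume e: "{y, z} \<in> path_edges (odd_path m i) (2 * m - 1)"
  have "pair_sum m {y, z} = y + z" using assms by (intro pair_sum_doubleton(2)) auto
  moreover have "y + z \<in> sum_class m y" using assms unfolding sum_class_def by auto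
  ultimately have "i = y" using sum_class_disjoint assms(1,2) odd_path_sum[OF assms(1) e] by simp
  moreover have "y \<in> odd_path m i ` {..2 * m - 1}"
    using e unfolding path_edges_def by (auto simp: doubleton_eq_iff)
  ultimately show False using odd_path_range[OF assms(1)] by (metis atMost_iff imageE)
qed

lemma avoidable_odd:
  assumes "3 \<le> m"
  shows "avoidable (2 * m + 1) (m + 1) {{0, m - 1}}"
proof (rule avoidable_almost_hamiltonian_paths[where l = "2 * m - 1" and
      P = "\<lambda>i. if i < m then odd_path m i else last_path m" and x = "\<lambda>i. if i < m then i else 2 * m"])
  let ?P = "\<lambda>i. if i < m then odd_path m i else last_path m"
  show "0 < 2 * m - 1" "2 * m + 1 = 2 * m - 1 + 2" using assms by auto
  show "inj_on (\<lambda>i. if i < m then i else 2 * m) {..<m + 1}" by (auto simp: inj_on_def)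
  fix i assume i: "i < m + 1"
  show "inj_on (?P i) {..2 * m - 1}" using inj_odd_path inj_last_path by auto
  show "(if i < m then i else 2 * m) < 2 * m + 1" by auto
  show "?P i t < 2 * m + 1 \<and> ?P i t \<noteq> (if i < m then i else 2 * m)" if "t \<le> 2 * m - 1" for t
    using that odd_path_range[of i m t] assms by (auto simp: last_path_def)
  show "path_edges (?P i) (2 * m - 1) \<inter> {{0, m - 1}} = {}"
  proof (cases "i < m")
    case True
    then show ?thesis using odd_path_avoids[OF True, of 0 "m - 1"] assms by auto
  next
    case False
    have "{0, m - 1} \<notin> path_edges (last_path m) (2 * m - 1)"
    proof
      assume "{0, m - 1} \<in> path_edges (last_path m) (2 * m - 1)"
      then show False
        by (rule last_path_edges[rotated]) (use assms in \<open>auto simp: doubleton_eq_iff\<close>)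
    qed
    then show ?thesis using False by simp
  qed
next
  let ?P = "\<lambda>i. if i < m then odd_path m i else last_path m"
  fix i j assume ij: "i < j" "j < m + 1"
  then have i: "i < m" by simp
  show "path_edges (?P i) (2 * m - 1) \<inter> path_edges (?P j) (2 * m - 1) = {}"
  proof (cases "j < m")
    case True
    have "False" if "e \<in> path_edges (odd_path m i) (2 * m - 1)" "e \<in> path_edges (odd_path m j) (2 * m - 1)" for e
      using sum_class_disjoint[OF i True odd_path_sum[OF i that(1)] odd_path_sum[OF True that(2)]] ij by simp
    then show ?thesis using i True by auto
  next
    case False
    have "False" if e: "e \<in> path_edges (odd_path m i) (2 * m - 1)" "e \<in> path_edges (last_path m) (2 * m - 1)" for e
    proof -
      have "0 < m" using i by simp
      from this e(2) show False
      proof (rule last_path_edges)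
        fix y assume "y < m" "e = {y, y + m}"
        then show False using odd_path_avoids[OF i, of y "y + m"] e(1) by auto
      next
        fix y assume "0 < y" "y < m" "e = {y, y + m - 1}"
        then show False using odd_path_avoids[OF i, of y "y + m - 1"] e(1) assms by auto
      qed
    qed
    then show ?thesis using i False by auto
  qed
  have "2 * m - 1 = Suc (2 * (m - 1))" using assms by simp
  then have ends: "odd_path m i 0 = i + m" "odd_path m i (2 * m - 1) = i + m - 1"
    "odd_path m i 1 = (if i = 0 then 2 * m - 1 else i - 1)"
    "last_path m 0 = 2 * m - 1" "last_path m (2 * m - 1) = 0" if "i < m" for i
    using that assms by (auto simp: odd_path_def last_path_def)
  \<comment> \<open>Ends are shared only for \<open>j = Suc i\<close>, including
    \<open>i = m - 1\<close> and the last path. The shared end is \<open>?P i 0\<close>, and the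
    second alternative holds because \<open>3 \<le> m\<close>.\<close>
  show "{?P i 0, ?P i (2 * m - 1)} \<inter> {?P j 0, ?P j (2 * m - 1)} = {} \<or>
      {?P i 1, ?P i (2 * m - 1)} \<inter> {?P j 0, ?P j (2 * m - 1)} = {} \<and>
      (if j < m then j else 2 * m) \<notin> {?P i 0, ?P i 1}"
  proof (cases "j < m")
    case True
    have "{i + m, i + m - 1} \<inter> {j + m, j + m - 1} = {} \<or>
        {if i = 0 then 2 * m - 1 else i - 1, i + m - 1} \<inter> {j + m, j + m - 1} = {} \<and>
        j \<notin> {i + m, if i = 0 then 2 * m - 1 else i - 1}"
    proof (cases "j = Suc i")
      case True
      then show ?thesis using \<open>j < m\<close> assms by auto
    next
      case False
      then show ?thesis using ij by auto
    qed
    then show ?thesis using True i ends(1-3)[OF i] ends(1,2)[OF True] by simp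
  next
    case False
    have "{i + m, i + m - 1} \<inter> {2 * m - 1, 0} = {} \<or>
        {if i = 0 then 2 * m - 1 else i - 1, i + m - 1} \<inter> {2 * m - 1, 0} = {} \<and>
        2 * m \<notin> {i + m, if i = 0 then 2 * m - 1 else i - 1}"
      using i assms by (cases "i = m - 1") auto
    then show ?thesis using False i ends[OF i] by simp
  qed
qed

section \<open>Orders four and five\<close>

lemma path_edges_2: "path_edges p 2 = {{p 0, p 1}, {p 1, p 2}}"
  and path_edges_3: "path_edges p 3 = {{p 0, p 1}, {p 1, p 2}, {p 2, p 3}}"
proof -
  have "path_edges p (Suc l) = insert {p l, p (Suc l)} (path_edges p l)" for l
    unfolding path_edges_def by (auto simp: less_Suc_eq)
  moreover have "path_edges p 0 = {}" unfolding path_edges_def by simp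
  ultimately show "path_edges p 2 = {{p 0, p 1}, {p 1, p 2}}"
    "path_edges p 3 = {{p 0, p 1}, {p 1, p 2}, {p 2, p 3}}"
    by (simp_all add: numeral_eq_Suc) blast+
qed

text \<open>The paths \<open>1, 3, 2\<close> and \<open>1, 2, 0, 3\<close> use up all five edges
  other than \<open>{0, 1}\<close>.\<close>

lemma avoidable_four: "avoidable 4 2 {{0, 1}}"
proof -
  define p :: "nat \<Rightarrow> nat" where "p = nth [1, 3, 2]"
  define q :: "nat \<Rightarrow> nat" where "q = nth [1, 2, 0, 3]"
  have vals: "p 0 = 1" "p 1 = 3" "p (Suc 0) = 3" "p 2 = 2" "p (Suc 1) = 2"
    "q 0 = 1" "q 1 = 2" "q (Suc 0) = 2" "q 2 = 0" "q (Suc 1) = 0" "q 3 = 3" "q (Suc 2) = 3"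
    unfolding p_def q_def by (simp_all add: numeral_eq_Suc)
  have at_most: "{..2 :: nat} = {0, 1, 2}" "{..3 :: nat} = {0, 1, 2, 3}" "{..<4 :: nat} = {0, 1, 2, 3}" by auto
  have less: "t < 2 \<longleftrightarrow> t = 0 \<or> t = 1" "t < 3 \<longleftrightarrow> t = 0 \<or> t = 1 \<or> t = 2" for t :: nat by auto
  have inj: "inj_on p {..2}" "inj_on q {..3}" by (simp_all add: at_most vals)
  have im: "p ` {..2} = {1, 2, 3}" "q ` {..3} = {0, 1, 2, 3}" by (auto simp: at_most vals)
  have pe: "path_edges p 2 = {{1, 3}, {3, 2}}" "path_edges q 3 = {{1, 2}, {2, 0}, {0, 3}}"
    by (simp_all only: path_edges_2 path_edges_3 vals)
  have disj: "path_edges p 2 \<inter> path_edges q 3 = {}" unfolding pe by (simp add: doubleton_eq_iff)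
  have sub: "path_edges p 2 \<subseteq> edges (complete_graph 4)" "path_edges q 3 \<subseteq> edges (complete_graph 4)"
    by (intro path_edges_complete; simp add: inj im)+
  \<comment> \<open>The vertex \<open>0 = q 2\<close>, missed by \<open>p\<close>, must not be
    picked. The only vertex picked on both sides is \<open>3\<close>, and there the edge
    \<open>{1, 3}\<close> of \<open>p\<close> picks \<open>1\<close>.\<close>
  define b :: "nat \<Rightarrow> nat" where "b s = (if s = 0 then 1 else if s = 1 then 1 else 3)" for s
  have linked: "linked (line_complete 4) (path_edges p 2) (path_edges q 3)"
  proof (rule linked_paths_pick[OF sub disj inj, where a = id and b = b])
    fix t s assume "t < (2 :: nat)" "s < (3 :: nat)" "p (id t) = q (b s)"
    then show "(\<exists>t'<2. id t \<in> {t', Suc t'} \<and> id t' \<noteq> id t) \<or> (\<exists>s'<3. b s \<in> {s', Suc s'} \<and> b s' \<noteq> b s)"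
      unfolding less by (intro disjI1 exI[of _ 0]) (auto simp: vals b_def)
  qed (auto simp: im less b_def vals)
  show ?thesis
  proof (rule avoidable_path_system[where x = "\<lambda>_. 0" and P = "\<lambda>i. if i = 0 then p else q"
        and l = "\<lambda>i. if i = 0 then 2 else 3"])
    fix i :: nat
    show "path_edges (if i = 0 then p else q) (if i = 0 then 2 else 3) \<inter> {{0, 1}} = {}"
      by (simp add: pe doubleton_eq_iff)
    show "inj_on (if i = 0 then p else q) {..if i = 0 then 2 else 3}" by (simp add: inj)
    show "(if i = 0 then p else q) ` {..if i = 0 then 2 else 3} \<subseteq> {..<4}"
      "{..<4} - {0} \<subseteq> (if i = 0 then p else q) ` {..if i = 0 then 2 else 3}"
      by (auto simp: im at_most(3))
  qed (auto simp: linked disj)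
qed

text \<open>For \<open>n = 5\<close> the edge count leaves no slack, and a four-cycle of assignments at \<open>b\<close> is needed,
  which a choice of ends as above cannot produce.\<close>

lemma linked_three_paths:
  assumes A: "A = {{x, a}, {a, b}, {b, y}}" "A \<subseteq> edges G" and B: "B = {{x, b}, {b, c}, {c, y}}" "B \<subseteq> edges G"
    and d: "distinct [x, y, a, b, c]"
  shows "linked (line_graph G) A B"
proof -
  \<comment> \<open>The four-cycle is \<open>{x, b}\<close>, \<open>{a, b}\<close>,
    \<open>{b, c}\<close>, \<open>{b, y}\<close>; the edges \<open>{x, a}\<close> and
    \<open>{c, y}\<close> are sent into it.\<close>
  define h where "h e = (if e = {x, a} \<or> e = {b, y} then {x, b} else if e = {a, b} then {b, c}
    else if e = {x, b} then {a, b} else {b, y})" for e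
  have ne: "x \<noteq> y" "x \<noteq> a" "x \<noteq> b" "x \<noteq> c" "y \<noteq> x" "y \<noteq> a" "y \<noteq> b" "y \<noteq> c" "a \<noteq> x" "a \<noteq> y" "a \<noteq> b" "a \<noteq> c" 
    "b \<noteq> x" "b \<noteq> y" "b \<noteq> a" "b \<noteq> c" "c \<noteq> x" "c \<noteq> y" "c \<noteq> a" "c \<noteq> b"
    using d by auto
  have h: "h {x, a} = {x, b}" "h {b, y} = {x, b}" "h {a, b} = {b, c}" "h {x, b} = {a, b}"
    "h {b, c} = {b, y}" "h {c, y} = {b, y}"
    using ne unfolding h_def by (simp_all add: doubleton_eq_iff)
  have G: "{x, a} \<in> edges G" "{a, b} \<in> edges G" "{b, y} \<in> edges G"
    "{x, b} \<in> edges G" "{b, c} \<in> edges G" "{c, y} \<in> edges G" using A B by auto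
  show ?thesis
    unfolding linked_def A(1) B(1)
    by (intro exI[of _ h]) (simp add: h G ne line_graph_edge_iff doubleton_eq_iff)
qed

text \<open>Three paths from \<open>0\<close> to \<open>3\<close> through the consecutive pairs of
  the cyclic order \<open>1, 2, 4\<close> use up all nine edges other than \<open>{0, 3}\<close>. By
  this symmetry, all links are instances of one lemma.\<close>

lemma avoidable_five: "avoidable 5 3 {{0, 3}}"
proof -
  define P :: "nat \<Rightarrow> nat \<Rightarrow> nat" where
    "P i = nth ([[0, 1, 2, 3], [0, 2, 4, 3], [0, 4, 1, 3]] ! i)" for i
  define x :: "nat \<Rightarrow> nat" where "x = nth [4, 1, 2]"
  have less: "t < 3 \<longleftrightarrow> t = 0 \<or> t = 1 \<or> t = 2" for t :: nat by auto
  have at_most: "{..3 :: nat} = {0, 1, 2, 3}" "{..<5 :: nat} = {0, 1, 2, 3, 4}" by auto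
  have P: "P 0 0 = 0" "P 0 1 = 1" "P 0 2 = 2" "P 0 3 = 3" "P 1 0 = 0" "P 1 1 = 2" "P 1 2 = 4"
    "P 1 3 = 3" "P 2 0 = 0" "P 2 1 = 4" "P 2 2 = 1" "P 2 3 = 3"
    and x: "x 0 = 4" "x 1 = 1" "x 2 = 2"
    unfolding P_def x_def by (simp_all add: numeral_eq_Suc)
  have pe: "path_edges (P 0) 3 = {{0, 1}, {1, 2}, {2, 3}}" "path_edges (P 1) 3 = {{0, 2}, {2, 4}, {4, 3}}"
    "path_edges (P 2) 3 = {{0, 4}, {4, 1}, {1, 3}}"
    by (simp_all only: path_edges_3 P)
  have inj: "inj_on (P i) {..3}" if "i < 3" for i
    using that unfolding less by (elim disjE) (simp_all add: at_most P del: One_nat_def)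
  have im: "P i ` {..3} = {..<5} - {x i}" if "i < 3" for i
    using that unfolding less at_most by (elim disjE) (simp_all add: P x del: One_nat_def, auto)
  have sub: "path_edges (P i) 3 \<subseteq> edges (complete_graph 5)" if "i < 3" for i
    using path_edges_complete[OF inj[OF that]] im[OF that] by blast
  have linked: "linked (line_complete 5) (path_edges (P 0) 3) (path_edges (P 1) 3)"
    "linked (line_complete 5) (path_edges (P 1) 3) (path_edges (P 2) 3)"
    "linked (line_complete 5) (path_edges (P 2) 3) (path_edges (P 0) 3)"
    using sub by (intro linked_three_paths[OF pe(1) _ pe(2)] linked_three_paths[OF pe(2) _ pe(3)]
        linked_three_paths[OF pe(3) _ pe(1)]; simp)+
  show ?thesis
  proof (rule avoidable_path_system[where P = P and x = x and l = "\<lambda>_. 3"])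
    fix i j :: nat assume "i < j" "j < 3"
    then have ij: "i = 0 \<and> j = 1 \<or> i = 1 \<and> j = 2 \<or> i = 0 \<and> j = 2" by auto
    then show "linked (line_complete 5) (path_edges (P i) 3) (path_edges (P j) 3)"
      using linked(1,2) linked_sym[OF linked(3)] by auto
    show "path_edges (P i) 3 \<inter> path_edges (P j) 3 = {}"
      using ij by (elim disjE conjE) (simp_all add: pe doubleton_eq_iff del: One_nat_def)
  next
    fix i :: nat assume "i < 3"
    then show "path_edges (P i) 3 \<inter> {{0, 3}} = {}"
      unfolding less by (elim disjE) (simp_all add: pe doubleton_eq_iff del: One_nat_def)
  qed (use inj im in auto)
qed

section \<open>Deleting induced paths\<close>

text \<open>The complements of the two lists have equal size, so any bijection between them
  completes the permutation.\<close>

lemma bij_betw_extend_lists: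
  assumes N: "finite N" "set xs \<subseteq> N" "set ys \<subseteq> N"
    and d: "distinct xs" "distinct ys" "length xs = length ys"
  obtains f where "bij_betw f N N" "map f xs = ys"
proof -
  define e where "e x = the (map_of (zip xs ys) x)" for x
  have e: "map e xs = ys"
    using d by (intro nth_equalityI) (auto simp: e_def map_of_zip_nth)
  then have im: "e ` set xs = set ys" by (metis list.set_map)
  have card: "card (set xs) = card (set ys)" using d by (simp add: distinct_card)
  then have "bij_betw e (set xs) (set ys)"
    unfolding bij_betw_def using im by (simp add: eq_card_imp_inj_on)
  moreover have "card (N - set xs) = card (N - set ys)" using N card by (simp add: card_Diff_subset)
  then obtain g where "bij_betw g (N - set xs) (N - set ys)"
    using N finite_same_card_bij by (metis finite_Diff)
  moreover define f where "f x = (if x \<in> set xs then e x else g x)" for x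
  ultimately have "bij_betw f (set xs \<union> (N - set xs)) (set ys \<union> (N - set ys))"
    unfolding f_def by (intro bij_betw_disjoint_Un) auto
  moreover have "set xs \<union> (N - set xs) = N" "set ys \<union> (N - set ys) = N" using N by auto
  moreover have "map f xs = map e xs" by (rule map_cong) (auto simp: f_def)
  ultimately show thesis using that[of f] e by simp
qed

text \<open>The induction prepends an edge \<open>e\<close> that meets the second edge
  \<open>f\<close> but no later one. Two edges form a separate case, since \<open>f\<close> alone
  does not determine which of its ends comes first.\<close>

lemma edge_list_is_path:
  assumes "\<And>i. i < length p \<Longrightarrow> card (p ! i) = 2" and "distinct p" "p \<noteq> []"
    and "\<And>i j. i < j \<Longrightarrow> j < length p \<Longrightarrow> p ! i \<inter> p ! j \<noteq> {} \<longleftrightarrow> j = Suc i"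
  obtains u where "distinct u" "length u = Suc (length p)"
    "\<And>i. i < length p \<Longrightarrow> p ! i = {u ! i, u ! Suc i}"
  using assms
proof (induction p arbitrary: thesis rule: induct_list012)
  case 1
  then show ?case by simp
next
  case (2 e)
  have "card e = 2" using "2.prems"(2)[of 0] by simp
  then obtain a b where "e = {a, b}" "a \<noteq> b" by (auto simp: card_2_iff)
  then show ?case by (intro "2.prems"(1)[of "[a, b]"]) auto
next
  case (3 e f r)
  have card: "card e = 2" "card f = 2" using "3.prems"(2)[of 0] "3.prems"(2)[of 1] by auto
  have ef: "e \<inter> f \<noteq> {}" "e \<noteq> f" using "3.prems"(5)[of 0 1] "3.prems"(3) by auto
  show ?case
  proof (cases r)
    case Nil
    obtain c where c: "c \<in> e" "c \<in> f" using ef by blast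
    obtain a where a: "e = {a, c}" "a \<noteq> c" using card(1) c(1) by (auto simp: card_2_iff)
    obtain b where b: "f = {c, b}" "b \<noteq> c" using card(2) c(2) by (auto simp: card_2_iff)
    have "a \<noteq> b" using a b ef by auto
    then show ?thesis
      using a b Nil by (intro "3.prems"(1)[of "[a, c, b]"]) (auto simp: less_Suc_eq)
  next
    case (Cons g r')
    let ?q = "f # r"
    have "card (?q ! i) = 2" if "i < length ?q" for i using "3.prems"(2)[of "Suc i"] that by simp
    moreover have "?q ! i \<inter> ?q ! j \<noteq> {} \<longleftrightarrow> j = Suc i" if "i < j" "j < length ?q" for i j
      using "3.prems"(5)[of "Suc i" "Suc j"] that by simp
    ultimately obtain u where u: "distinct u" "length u = Suc (length ?q)"
      "\<And>i. i < length ?q \<Longrightarrow> ?q ! i = {u ! i, u ! Suc i}"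
      using "3.IH"(2) "3.prems"(3) by (metis distinct.simps(2) list.distinct(1))
    have far: "e \<inter> ?q ! i = {}" if "0 < i" "i < length ?q" for i
      using "3.prems"(5)[of 0 "Suc i"] that by simp
    \<comment> \<open>Every vertex of \<open>u\<close> after the first lies on an edge after
      \<open>f\<close>, and these avoid \<open>e\<close>. Hence \<open>e\<close> meets
      \<open>f\<close> in \<open>u ! 0\<close>.\<close>
    have later: "u ! i \<notin> e" if i: "0 < i" "i < length u" for i
    proof (cases "i = 1")
      case True
      then show ?thesis using far[of 1] u(3)[of 1] Cons by auto
    next
      case False
      then obtain j where j: "i = Suc j" "0 < j" using i(1) by (cases i) auto
      then show ?thesis using far[of j] u(2) u(3)[of j] i by auto
    qed
    have "f = {u ! 0, u ! 1}" using u(3)[of 0] by simp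
    then have "u ! 0 \<in> e" using ef(1) later[of 1] u(2) by auto
    then obtain w where w: "e = {w, u ! 0}" "w \<noteq> u ! 0" using card(1) by (auto simp: card_2_iff)
    have "w \<notin> set u"
    proof
      assume "w \<in> set u"
      then obtain i where i: "i < length u" "w = u ! i" by (metis in_set_conv_nth)
      then show False using later[of i] w by (cases i) auto
    qed
    moreover have "(e # f # r) ! i = {(w # u) ! i, (w # u) ! Suc i}" if "i < length (e # f # r)" for i
      using that w u(3)[of "i - 1"] by (cases i) auto
    ultimately show ?thesis using u by (intro "3.prems"(1)[of "w # u"]) auto
  qed
qed

text \<open>Induced paths of the line graph come from paths of \<open>K_n\<close> with one more
  vertex, which a permutation can move freely.\<close>

lemma induced_path_line_complete:
  assumes "induced_path (line_complete n) P"
  obtains u where "distinct u" "set u \<subseteq> {..<n}" "length u = Suc (card P)"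
    "P = {{u ! i, u ! Suc i} |i. i < card P}"
proof -
  obtain p where p: "p \<noteq> []" "distinct p" "P = set p"
    and e: "{e \<in> edges (line_complete n). e \<subseteq> P} = walk_edges p" and P: "P \<subseteq> vertices (line_complete n)"
    using assms unfolding induced_path_def is_path_graph_def induced_sgraph_def by (auto simp: Int_absorb1)
  have mem: "p ! i \<subseteq> {..<n}" "card (p ! i) = 2" if "i < length p" for i
    using that P p(3) nth_mem unfolding vertices_line_complete by blast+
  have adj: "p ! i \<inter> p ! j \<noteq> {} \<longleftrightarrow> j = Suc i" if ij: "i < j" "j < length p" for i j
  proof -
    have i: "i < length p" using ij by simp
    have "p ! i \<noteq> p ! j" using p(2) ij by (simp add: nth_eq_iff_index_eq)
    then have "p ! i \<inter> p ! j \<noteq> {} \<longleftrightarrow> {p ! i, p ! j} \<in> edges (line_complete n)"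
      using mem[OF i] mem[OF ij(2)] by (simp add: line_graph_edge_iff complete_graph_def)
    also have "\<dots> \<longleftrightarrow> {p ! i, p ! j} \<in> walk_edges p"
      using i ij p(3) unfolding e[symmetric] by auto
    also have "\<dots> \<longleftrightarrow> j = Suc i"
    proof
      assume "{p ! i, p ! j} \<in> walk_edges p"
      then obtain t where "Suc t < length p" "{p ! i, p ! j} = {p ! t, p ! Suc t}"
        unfolding walk_edges_def by blast
      then show "j = Suc i"
        using p(2) i ij by (auto simp: doubleton_eq_iff nth_eq_iff_index_eq)
    next
      assume "j = Suc i"
      then show "{p ! i, p ! j} \<in> walk_edges p" unfolding walk_edges_def using ij by auto
    qed
    finally show ?thesis .
  qed
  obtain u where u: "distinct u" "length u = Suc (length p)"
    "\<And>i. i < length p \<Longrightarrow> p ! i = {u ! i, u ! Suc i}"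
    using edge_list_is_path[OF mem(2) p(2,1) adj] by blast
  have card: "card P = length p" using p by (simp add: distinct_card)
  have "u ! i < n" if "i < length u" for i
  proof (cases i)
    case 0
    then show ?thesis using mem(1)[of 0] u(3)[of 0] p(1) by auto
  next
    case (Suc j)
    then show ?thesis using mem(1)[of j] u(2) u(3)[of j] that by auto
  qed
  then have "set u \<subseteq> {..<n}" by (auto simp: in_set_conv_nth)
  moreover have "P = {{u ! i, u ! Suc i} |i. i < card P}"
    unfolding card using u(3) unfolding p(3) set_conv_nth by metis
  ultimately show thesis using that[of u] u(1,2) unfolding card by blast
qed

section \<open>Moving the deleted set into standard position\<close>

lemma avoidable_singleton:
  assumes "avoidable n k {{c, d}}" "c \<noteq> d" "c < n" "d < n" "v \<in> vertices (line_complete n)"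
  shows "avoidable n k {v}"
proof -
  obtain a b where v: "v = {a, b}" "a \<noteq> b" "a < n" "b < n"
    using assms(5) by (auto simp: vertices_line_complete card_2_iff)
  obtain f where "bij_betw f {..<n} {..<n}" "map f [c, d] = [a, b]"
    using bij_betw_extend_lists[of "{..<n}" "[c, d]" "[a, b]"] assms v by auto
  then show ?thesis
    using avoidable_image[OF assms(1), of f] assms(2-4) v
    by (simp add: vertices_line_complete)
qed

lemma avoidable_induced_path:
  assumes "avoidable n k {{t, Suc t} |t. t < k}" "k < n"
    and P: "induced_path (line_complete n) P" "card P \<le> k"
  obtains X where "avoidable n k X" "P \<subseteq> X"
proof -
  obtain u where u: "distinct u" "set u \<subseteq> {..<n}" "length u = Suc (card P)"
    "P = {{u ! i, u ! Suc i} |i. i < card P}"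
    using induced_path_line_complete[OF P(1)] by blast
  \<comment> \<open>An initial segment of the standard path \<open>0, 1, \<dots>, k\<close> is
    mapped onto \<open>u\<close>; it is long enough because \<open>card P \<le> k\<close>.\<close>
  have "set [0..<length u] \<subseteq> {..<n}" using u(3) assms(2) P(2) by auto
  then obtain f where f: "bij_betw f {..<n} {..<n}" "map f [0..<length u] = u"
    using bij_betw_extend_lists[of "{..<n}" "[0..<length u]" u] u(1,2) by auto
  have fu: "f i = u ! i" if "i < length u" for i
    using f(2) that by (metis add_0 diff_zero length_upt nth_map nth_upt)
  have "P \<subseteq> (`) f ` {{t, Suc t} |t. t < k}"
  proof
    fix e assume "e \<in> P"
    then obtain i where i: "i < card P" "e = {u ! i, u ! Suc i}" using u(4) by blast
    then have "e = f ` {i, Suc i}" using fu u(3) by auto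
    moreover have "{i, Suc i} \<in> {{t, Suc t} |t. t < k}" using i(1) P(2) by auto
    ultimately show "e \<in> (`) f ` {{t, Suc t} |t. t < k}" by (rule image_eqI)
  qed
  moreover have "{{t, Suc t} |t. t < k} \<subseteq> vertices (line_complete n)"
    using assms(2) by (auto simp: vertices_line_complete)
  ultimately show thesis using that avoidable_image[OF assms(1) f(1)] by blast
qed

lemma delete_vertices_empty: "delete_vertices (line_graph G) {} = line_graph G"
  unfolding delete_vertices_def induced_sgraph_def line_graph_def by auto

theorem theorem2:
  fixes n :: nat
  assumes "4 \<le> n"
  shows "has_cists (line_graph (complete_graph n)) ((n + 1) div 2) \<and>
    (n = 4 \<or> (odd n \<and> 5 \<le> n) \<longrightarrow>
      (\<forall>v\<in>vertices (line_graph (complete_graph n)).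
         has_cists (delete_vertices (line_graph (complete_graph n)) {v}) ((n + 1) div 2))) \<and>
    (even n \<and> 6 \<le> n \<longrightarrow>
      (\<forall>P. induced_path (line_graph (complete_graph n)) P \<and> card P \<le> n div 2 \<longrightarrow>
         has_cists (delete_vertices (line_graph (complete_graph n)) P) ((n + 1) div 2)))"
proof -
  define k where "k = (n + 1) div 2"
  have "0 < k" using assms unfolding k_def by auto
  have vertex: "\<exists>c d. avoidable n k {{c, d}} \<and> c \<noteq> d \<and> c < n \<and> d < n" if n: "n = 4 \<or> odd n"
  proof -
    consider "n = 4" | "n = 5" | m where "3 \<le> m" "n = 2 * m + 1"
    proof (cases "n = 4 \<or> n = 5")
      case False
      then have "odd n" using n by auto
      then obtain m where "n = 2 * m + 1" by (elim oddE)
      moreover from this have "3 \<le> m" using False assms by auto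
      ultimately show ?thesis using that by blast
    qed (use that in auto)
    then show ?thesis
    proof cases
      case 1
      then show ?thesis using avoidable_four unfolding k_def by (intro exI[of _ 0] exI[of _ 1]) simp
    next
      case 2
      then show ?thesis using avoidable_five unfolding k_def by (intro exI[of _ 0] exI[of _ 3]) simp
    next
      case (3 m)
      then have "k = m + 1" unfolding k_def by simp
      then show ?thesis
        using avoidable_odd[OF 3(1)] 3 by (intro exI[of _ 0] exI[of _ "m - 1"]) simp
    qed
  qed
  have path: "avoidable n k {{t, Suc t} |t. t < k}" "k = n div 2" if "even n" "6 \<le> n"
  proof -
    obtain m where "n = 2 * m" using \<open>even n\<close> by (elim evenE)
    moreover from this have "k = m" "3 \<le> m" using that unfolding k_def by auto
    ultimately show "avoidable n k {{t, Suc t} |t. t < k}" "k = n div 2" using avoidable_even by auto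
  qed
  \<comment> \<open>For the undeleted graph any \<open>X\<close> will do, with the empty subset
    deleted.\<close>
  have "\<exists>X. avoidable n k X"
  proof (cases "n = 4 \<or> odd n")
    case False
    then have "6 \<le> n" using assms by presburger
    then show ?thesis using False path by blast
  qed (use vertex in blast)
  then have "has_cists (line_complete n) k"
    using has_cists_delete[OF _ \<open>0 < k\<close>, of n _ "{}"] by (auto simp: delete_vertices_empty)
  moreover have "has_cists (delete_vertices (line_complete n) {v}) k"
    if "n = 4 \<or> (odd n \<and> 5 \<le> n)" "v \<in> vertices (line_complete n)" for v
    using vertex avoidable_singleton has_cists_delete[OF _ \<open>0 < k\<close>] that by blast
  moreover have "has_cists (delete_vertices (line_complete n) P) k"
    if P: "even n" "6 \<le> n" "induced_path (line_complete n) P" "card P \<le> n div 2" for P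
  proof -
    have "k < n" "card P \<le> k" using path(2) P by auto
    then obtain X where "avoidable n k X" "P \<subseteq> X"
      using avoidable_induced_path[OF path(1)[OF P(1,2)] _ P(3)] by blast
    then show ?thesis using has_cists_delete[OF _ \<open>0 < k\<close>] by blast
  qed
  ultimately show ?thesis unfolding k_def by blast
qed

end
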